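(* Let $R\subseteq S$ be an extension of integral domains and let $G$ be a finite subgroup of $\mathrm{Aut}(S)$ such that $\sigma(R)\subseteq R$ for all $\sigma\in G$. If $(R,S)$ is a PVD-pair, then $(R^G,S^G)$ is also a PVD-pair.
   Context: All rings are commutative with unity, and subrings share the unity. $\mathrm{Aut}(S)$ is the group of ring automorphisms of $S$. $S^G=\{s\in S : \sigma(s)=s \text{ for all } \sigma\in G\}$ and $R^G=\{r\in R : \sigma(r)=r \text{ for all } \sigma\in G\}=R\cap S^G$. An overring of an integral domain $D$ is a subring of the quotient field of $D$ containing $D$. An integral domain $D$ is a pseudo-valuation domain (PVD) if there exists a (uniquely determined) valuation overring $V$ of $D$ such that $\mathrm{Spec}(D)=\mathrm{Spec}(V)$ as sets (i.e. the prime ideals of $D$ and of $V$ are the same subsets). A pair $(R,S)$ with $R\subseteq S$ is a PVD-pair if every intermediate ring $T$ with $R\subseteq T\subseteq S$ is a PVD. *)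

theory Defs
  imports "HOL-Algebra.Algebra"
begin

section \<open>The quotient field of an integral domain\<close>

definition frac_rel :: "('a, 'm) ring_scheme \<Rightarrow> (('a \<times> 'a) \<times> ('a \<times> 'a)) set" where
  "frac_rel D =
     {((a, b), (c, d)).
        a \<in> carrier D \<and> b \<in> carrier D - {\<zero>\<^bsub>D\<^esub>} \<and>
        c \<in> carrier D \<and> d \<in> carrier D - {\<zero>\<^bsub>D\<^esub>} \<and>
        a \<otimes>\<^bsub>D\<^esub> d = c \<otimes>\<^bsub>D\<^esub> b}"

definition fraction :: "('a, 'm) ring_scheme \<Rightarrow> 'a \<Rightarrow> 'a \<Rightarrow> ('a \<times> 'a) set" where
  "fraction D a b = frac_rel D `` {(a, b)}"

definition quotient_field :: "('a, 'm) ring_scheme \<Rightarrow> ('a \<times> 'a) set ring" where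
  "quotient_field D =
     \<lparr>carrier = (carrier D \<times> (carrier D - {\<zero>\<^bsub>D\<^esub>})) // frac_rel D,
      monoid.mult = (\<lambda>x y. \<Union>(a, b)\<in>x. \<Union>(c, d)\<in>y. fraction D (a \<otimes>\<^bsub>D\<^esub> c) (b \<otimes>\<^bsub>D\<^esub> d)),
      monoid.one = fraction D \<one>\<^bsub>D\<^esub> \<one>\<^bsub>D\<^esub>,
      ring.zero = fraction D \<zero>\<^bsub>D\<^esub> \<one>\<^bsub>D\<^esub>,
      ring.add = (\<lambda>x y. \<Union>(a, b)\<in>x. \<Union>(c, d)\<in>y.
               fraction D ((a \<otimes>\<^bsub>D\<^esub> d) \<oplus>\<^bsub>D\<^esub> (c \<otimes>\<^bsub>D\<^esub> b)) (b \<otimes>\<^bsub>D\<^esub> d))\<rparr>"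

definition to_frac :: "('a, 'm) ring_scheme \<Rightarrow> 'a \<Rightarrow> ('a \<times> 'a) set" where
  "to_frac D a = fraction D a \<one>\<^bsub>D\<^esub>"

context domain
begin

lemma frac_rel_trans:
  assumes "((a, b), (c, d)) \<in> frac_rel R" "((c, d), (e, f)) \<in> frac_rel R"
  shows "((a, b), (e, f)) \<in> frac_rel R"
proof -
  have m: "a \<in> carrier R" "b \<in> carrier R" "c \<in> carrier R" "d \<in> carrier R" "e \<in> carrier R"
    "f \<in> carrier R" "b \<noteq> \<zero>" "d \<noteq> \<zero>" "f \<noteq> \<zero>"
    and 1: "a \<otimes> d = c \<otimes> b" and 2: "c \<otimes> f = e \<otimes> d"
    using assms by (auto simp: frac_rel_def)
  have "d \<otimes> (a \<otimes> f) = (a \<otimes> d) \<otimes> f" using m by (simp add: m_ac)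
  also have "\<dots> = (c \<otimes> f) \<otimes> b" using m by (simp add: 1 m_ac)
  also have "\<dots> = d \<otimes> (e \<otimes> b)" using m by (simp add: 2 m_ac)
  finally have "a \<otimes> f = e \<otimes> b" using m m_lcancel[of d] by simp
  with m show ?thesis by (auto simp: frac_rel_def)
qed

lemma equiv_frac_rel: "equiv (carrier R \<times> (carrier R - {\<zero>})) (frac_rel R)"
proof (rule equivI)
  show "frac_rel R \<subseteq> (carrier R \<times> (carrier R - {\<zero>})) \<times> (carrier R \<times> (carrier R - {\<zero>}))"
    by (auto simp: frac_rel_def)
  show "refl_on (carrier R \<times> (carrier R - {\<zero>})) (frac_rel R)"
    by (auto simp: refl_on_def frac_rel_def)
  show "sym (frac_rel R)" by (auto simp: sym_def frac_rel_def)
  show "trans (frac_rel R)"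
    by (rule transI) (metis frac_rel_trans surj_pair)
qed

lemma frac_eq_iff:
  assumes "a \<in> carrier R" "b \<in> carrier R - {\<zero>}" "c \<in> carrier R" "d \<in> carrier R - {\<zero>}"
  shows "fraction R a b = fraction R c d \<longleftrightarrow> a \<otimes> d = c \<otimes> b"
proof -
  have "fraction R a b = fraction R c d \<longleftrightarrow> ((a, b), (c, d)) \<in> frac_rel R"
    unfolding fraction_def using assms by (intro eq_equiv_class_iff[OF equiv_frac_rel]) auto
  then show ?thesis using assms by (auto simp: frac_rel_def)
qed

lemma carrier_quotient_field:
  "carrier (quotient_field R) = {fraction R a b | a b. a \<in> carrier R \<and> b \<in> carrier R - {\<zero>}}"
  by (auto simp: quotient_field_def quotient_def fraction_def)

lemma fraction_closed:
  "a \<in> carrier R \<Longrightarrow> b \<in> carrier R - {\<zero>} \<Longrightarrow> fraction R a b \<in> carrier (quotient_field R)"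
  by (auto simp: carrier_quotient_field)

lemma frac_cases:
  assumes "x \<in> carrier (quotient_field R)"
  obtains a b where "x = fraction R a b" "a \<in> carrier R" "b \<in> carrier R" "b \<noteq> \<zero>"
  using assms by (auto simp: carrier_quotient_field)

lemma nonzero_mult: "b \<in> carrier R - {\<zero>} \<Longrightarrow> d \<in> carrier R - {\<zero>} \<Longrightarrow> b \<otimes> d \<in> carrier R - {\<zero>}"
  using integral_iff by auto

lemma frac_mult:
  assumes "a \<in> carrier R" "b \<in> carrier R - {\<zero>}" "c \<in> carrier R" "d \<in> carrier R - {\<zero>}"
  shows "fraction R a b \<otimes>\<^bsub>quotient_field R\<^esub> fraction R c d = fraction R (a \<otimes> c) (b \<otimes> d)"
proof -
  have "(\<lambda>p q. case p of (a, b) \<Rightarrow> case q of (c, d) \<Rightarrow> fraction R (a \<otimes> c) (b \<otimes> d)) respects2 frac_rel R"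
  proof (rule congruent2I', clarify)
    fix a b a' b' c d c' d'
    assume "((a, b), (a', b')) \<in> frac_rel R" "((c, d), (c', d')) \<in> frac_rel R"
    then have m: "a \<in> carrier R" "b \<in> carrier R - {\<zero>}" "a' \<in> carrier R" "b' \<in> carrier R - {\<zero>}"
      "c \<in> carrier R" "d \<in> carrier R - {\<zero>}" "c' \<in> carrier R" "d' \<in> carrier R - {\<zero>}"
      and 1: "a \<otimes> b' = a' \<otimes> b" and 2: "c \<otimes> d' = c' \<otimes> d"
      by (auto simp: frac_rel_def)
    have "(a \<otimes> c) \<otimes> (b' \<otimes> d') = (a \<otimes> b') \<otimes> (c \<otimes> d')" using m by (simp add: m_ac)
    also have "\<dots> = (a' \<otimes> c') \<otimes> (b \<otimes> d)" unfolding 1 2 using m by (simp add: m_ac)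
    finally show "fraction R (a \<otimes> c) (b \<otimes> d) = fraction R (a' \<otimes> c') (b' \<otimes> d')"
      using m nonzero_mult by (subst frac_eq_iff) auto
  qed
  from UN_equiv_class2[OF equiv_frac_rel equiv_frac_rel this, of "(a, b)" "(c, d)"]
  show ?thesis using assms by (simp add: quotient_field_def fraction_def case_prod_unfold)
qed

lemma frac_add:
  assumes "a \<in> carrier R" "b \<in> carrier R - {\<zero>}" "c \<in> carrier R" "d \<in> carrier R - {\<zero>}"
  shows "fraction R a b \<oplus>\<^bsub>quotient_field R\<^esub> fraction R c d = fraction R (a \<otimes> d \<oplus> c \<otimes> b) (b \<otimes> d)"
proof -
  have "(\<lambda>p q. case p of (a, b) \<Rightarrow> case q of (c, d) \<Rightarrow> fraction R (a \<otimes> d \<oplus> c \<otimes> b) (b \<otimes> d))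
          respects2 frac_rel R"
  proof (rule congruent2I', clarify)
    fix a b a' b' c d c' d'
    assume "((a, b), (a', b')) \<in> frac_rel R" "((c, d), (c', d')) \<in> frac_rel R"
    then have m: "a \<in> carrier R" "b \<in> carrier R - {\<zero>}" "a' \<in> carrier R" "b' \<in> carrier R - {\<zero>}"
      "c \<in> carrier R" "d \<in> carrier R - {\<zero>}" "c' \<in> carrier R" "d' \<in> carrier R - {\<zero>}"
      and 1: "a \<otimes> b' = a' \<otimes> b" and 2: "c \<otimes> d' = c' \<otimes> d"
      by (auto simp: frac_rel_def)
    have "(a \<otimes> d \<oplus> c \<otimes> b) \<otimes> (b' \<otimes> d') = (a \<otimes> b') \<otimes> (d \<otimes> d') \<oplus> (c \<otimes> d') \<otimes> (b \<otimes> b')"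
      using m by (simp add: l_distr r_distr m_ac)
    also have "\<dots> = (a' \<otimes> d' \<oplus> c' \<otimes> b') \<otimes> (b \<otimes> d)"
      unfolding 1 2 using m by (simp add: l_distr r_distr m_ac)
    finally show "fraction R (a \<otimes> d \<oplus> c \<otimes> b) (b \<otimes> d) = fraction R (a' \<otimes> d' \<oplus> c' \<otimes> b') (b' \<otimes> d')"
      using m nonzero_mult by (subst frac_eq_iff) auto
  qed
  from UN_equiv_class2[OF equiv_frac_rel equiv_frac_rel this, of "(a, b)" "(c, d)"]
  show ?thesis using assms by (simp add: quotient_field_def fraction_def case_prod_unfold)
qed

lemma quotient_field_one: "\<one>\<^bsub>quotient_field R\<^esub> = fraction R \<one> \<one>"
  and quotient_field_zero: "\<zero>\<^bsub>quotient_field R\<^esub> = fraction R \<zero> \<one>"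
  by (simp_all add: quotient_field_def)

lemma field_quotient_field: "field (quotient_field R)"
proof -
  let ?K = "quotient_field R"
  note S = carrier_quotient_field quotient_field_one quotient_field_zero
  have nz: "b \<otimes> d \<noteq> \<zero>"
    if "b \<in> carrier R" "b \<noteq> \<zero>" "d \<in> carrier R" "d \<noteq> \<zero>" for b d
    using nonzero_mult that by blast
  note A = frac_mult frac_add frac_eq_iff nz
  have "cring ?K"
  proof (rule cringI)
    show "abelian_group ?K"
    proof (rule abelian_groupI)
      fix x assume "x \<in> carrier ?K"
      then obtain a b where x: "x = fraction R a b" "a \<in> carrier R" "b \<in> carrier R" "b \<noteq> \<zero>"
        by (auto simp: S)
      then have "fraction R (\<ominus> a) b \<oplus>\<^bsub>?K\<^esub> x = \<zero>\<^bsub>?K\<^esub>"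
        by (simp add: S A l_minus l_neg)
      moreover have "fraction R (\<ominus> a) b \<in> carrier ?K" using x by (simp add: fraction_closed)
      ultimately show "\<exists>y\<in>carrier ?K. y \<oplus>\<^bsub>?K\<^esub> x = \<zero>\<^bsub>?K\<^esub>" by blast
    next
      fix x y z assume "x \<in> carrier ?K" "y \<in> carrier ?K" "z \<in> carrier ?K"
      then show "x \<oplus>\<^bsub>?K\<^esub> y \<oplus>\<^bsub>?K\<^esub> z = x \<oplus>\<^bsub>?K\<^esub> (y \<oplus>\<^bsub>?K\<^esub> z)"
        by (auto simp: S A l_distr r_distr m_ac a_ac)
    next
      fix x y assume "x \<in> carrier ?K" "y \<in> carrier ?K"
      then show "x \<oplus>\<^bsub>?K\<^esub> y \<in> carrier ?K"
        by (auto simp: S A) (metis a_closed m_closed nz)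
    next
      fix x y assume "x \<in> carrier ?K" "y \<in> carrier ?K"
      then show "x \<oplus>\<^bsub>?K\<^esub> y = y \<oplus>\<^bsub>?K\<^esub> x"
        by (auto simp: S A l_distr r_distr m_ac a_ac)
    next
      show "\<zero>\<^bsub>?K\<^esub> \<in> carrier ?K" by (simp add: quotient_field_zero fraction_closed)
    qed (auto simp: S A)
    show "comm_monoid ?K"
    proof (rule comm_monoidI)
      fix x y assume "x \<in> carrier ?K" "y \<in> carrier ?K"
      then show "x \<otimes>\<^bsub>?K\<^esub> y \<in> carrier ?K"
        by (auto simp: S A) (metis m_closed nz)
    next
      show "\<one>\<^bsub>?K\<^esub> \<in> carrier ?K" by (simp add: quotient_field_one fraction_closed)
    qed (auto simp: S A m_ac)
    fix x y z assume "x \<in> carrier ?K" "y \<in> carrier ?K" "z \<in> carrier ?K"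
    then show "(x \<oplus>\<^bsub>?K\<^esub> y) \<otimes>\<^bsub>?K\<^esub> z = x \<otimes>\<^bsub>?K\<^esub> z \<oplus>\<^bsub>?K\<^esub> y \<otimes>\<^bsub>?K\<^esub> z"
      by (elim frac_cases) (simp add: A l_distr r_distr m_ac a_ac)
  qed
  then show ?thesis
  proof (rule cring.cring_fieldI2)
    show "\<zero>\<^bsub>?K\<^esub> \<noteq> \<one>\<^bsub>?K\<^esub>" by (simp add: S A)
    fix x assume x0: "x \<in> carrier ?K" "x \<noteq> \<zero>\<^bsub>?K\<^esub>"
    then obtain a b where x: "x = fraction R a b" "a \<in> carrier R" "b \<in> carrier R" "b \<noteq> \<zero>"
      by (auto simp: S)
    with x0 have "a \<noteq> \<zero>" by (auto simp: S A)
    note x = x this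
    then have "x \<otimes>\<^bsub>?K\<^esub> fraction R b a = \<one>\<^bsub>?K\<^esub>" by (simp add: S A m_comm)
    moreover have "fraction R b a \<in> carrier ?K" using x by (simp add: fraction_closed)
    ultimately show "\<exists>y\<in>carrier ?K. x \<otimes>\<^bsub>?K\<^esub> y = \<one>\<^bsub>?K\<^esub>" by blast
  qed
qed

lemma to_frac_hom: "to_frac R \<in> ring_hom R (quotient_field R)"
  by (rule ring_hom_memI)
    (auto simp: to_frac_def fraction_closed frac_mult frac_add quotient_field_one)

lemma inj_on_to_frac: "inj_on (to_frac R) (carrier R)"
  by (auto simp: inj_on_def to_frac_def frac_eq_iff)

lemma frac_eq_divide:
  assumes "a \<in> carrier R" "b \<in> carrier R - {\<zero>}"
  shows "fraction R a b \<otimes>\<^bsub>quotient_field R\<^esub> to_frac R b = to_frac R a"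
  using assms by (simp add: to_frac_def frac_mult frac_eq_iff nonzero_mult)

end


section \<open>Pseudo-valuation domains\<close>

definition overring :: "('a \<times> 'a) set set \<Rightarrow> ('a, 'm) ring_scheme \<Rightarrow> bool" where
  "overring V D \<longleftrightarrow> subring V (quotient_field D) \<and> to_frac D ` carrier D \<subseteq> V"

text \<open>An overring of \<open>D\<close> has the same quotient field as \<open>D\<close>, so an overring \<open>V\<close> of \<open>D\<close> is a
  valuation domain iff it is a valuation ring of the field \<open>quotient_field D\<close> in this sense.\<close>

definition valuation_ring :: "'k set \<Rightarrow> ('k, 'm) ring_scheme \<Rightarrow> bool" where
  "valuation_ring V K \<longleftrightarrow>
     subring V K \<and> (\<forall>x \<in> carrier K - {\<zero>\<^bsub>K\<^esub>}. x \<in> V \<or> inv\<^bsub>K\<^esub> x \<in> V)"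

definition Spec :: "('a, 'm) ring_scheme \<Rightarrow> 'a set set" where
  "Spec A = {P. primeideal P A}"

text \<open>The prime ideals of \<open>D\<close> and of \<open>V\<close> are compared as subsets of the quotient field, in which
  \<open>D\<close> is identified with its image under \<open>to_frac D\<close>.\<close>

definition PVD :: "('a, 'm) ring_scheme \<Rightarrow> bool" where
  "PVD D \<longleftrightarrow>
     domain D \<and>
     (\<exists>V. overring V D \<and> valuation_ring V (quotient_field D) \<and>
          Spec (quotient_field D \<lparr>carrier := to_frac D ` carrier D\<rparr>) =
          Spec (quotient_field D \<lparr>carrier := V\<rparr>))"

definition PVD_pair :: "'a set \<Rightarrow> ('a, 'm) ring_scheme \<Rightarrow> bool" where
  "PVD_pair R S \<longleftrightarrow>
     subring R S \<and> (\<forall>T. subring T S \<and> R \<subseteq> T \<longrightarrow> PVD (S \<lparr>carrier := T\<rparr>))"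


section \<open>Ring automorphisms and invariants\<close>

text \<open>As in \<^const>\<open>AutoGroup\<close>, automorphisms are extensional functions on the carrier.\<close>

definition ring_auto :: "('a, 'm) ring_scheme \<Rightarrow> ('a \<Rightarrow> 'a) set" where
  "ring_auto S = ring_hom S S \<inter> Bij (carrier S)"

definition RingAutoGroup :: "('a, 'm) ring_scheme \<Rightarrow> ('a \<Rightarrow> 'a) monoid" where
  "RingAutoGroup S = BijGroup (carrier S) \<lparr>carrier := ring_auto S\<rparr>"

definition fixed_set :: "('a \<Rightarrow> 'a) set \<Rightarrow> 'a set \<Rightarrow> 'a set" where
  "fixed_set G A = {a \<in> A. \<forall>\<sigma>\<in>G. \<sigma> a = a}"

end

theory Submission
  imports Defs "HOL-Algebra.Finite_Extensions" "HOL-Algebra.UnivPoly"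
begin

text \<open>
  A domain \<open>D\<close> is a pseudo-valuation domain iff for every \<open>x\<close> in its quotient field either \<open>x \<in> D\<close>
  or \<open>x\<inverse> m \<in> D\<close> for all nonunits \<open>m\<close> of \<open>D\<close>.  Written with \<open>x = a / b\<close>, this is the condition
  \<open>pseudo_valuative\<close> on elements of \<open>D\<close> (lemma \<open>PVD_iff_pseudo_valuative\<close>), and the theorem becomes a
  statement about divisibility in subrings of \<open>S\<close>.

  Let \<open>T\<close> lie between \<open>R\<^sup>G\<close> and \<open>S\<^sup>G\<close>, and let \<open>M\<close> be the set of nonunits of \<open>R\<close>.  If the nonunits of
  \<open>T\<close> all lie in \<open>M\<close>, the condition passes from \<open>R\<close> to \<open>T\<close>.  For if \<open>M \<noteq> {\<zero>}\<close>, every element of \<open>S\<close>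
  is a fraction over \<open>R\<close> (lemma \<open>pseudo_valuative_pair_fractions\<close>: otherwise some \<open>R \<oplus> c\<^sup>2 R[a]\<close> is an
  intermediate ring that violates the condition).  The condition for \<open>R\<close> can therefore be applied to
  \<open>a / b\<close> with \<open>a, b \<in> T\<close>, and a quotient in \<open>R\<close> of two \<open>G\<close>-invariant elements is \<open>G\<close>-invariant, hence
  in \<open>T\<close>.  If \<open>M = {\<zero>}\<close>, then \<open>T\<close> is a field.

  It remains to see that \<open>t \<in> T\<close> is a unit of \<open>T\<close> if it is not in \<open>M\<close>.  This is clear if \<open>t \<in> R\<close>.
  If \<open>t \<notin> R\<close>, then \<open>t x \<in> M\<close> implies \<open>x \<in> M\<close> (lemma \<open>pseudo_valuative_pair_cancel\<close>): in the case
  \<open>M \<noteq> {\<zero>}\<close> the reason is that \<open>t\<close> has nonpositive value for the valuation of \<open>R\<close>.  The ring \<open>R[t]\<close> is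
  a pseudo-valuation domain, hence local, so \<open>t\<close> or \<open>\<one> \<ominus> t\<close> is a unit of it; in the second case, too,
  there is an algebraic relation for \<open>t\<close> modulo \<open>M\<close>, and cancelling a power of \<open>t\<close> shows that
  \<open>t\<close> is a unit of \<open>R[t]\<close> (lemma \<open>inverse_in_local_simple_extension\<close>).  Taking the norm over \<open>G\<close> of the
  polynomial \<open>\<one> - X q\<close> with \<open>t q(t) = \<one>\<close>, one obtains an inverse of \<open>t\<close> in \<open>R\<^sup>G[t] \<subseteq> T\<close>
  (lemma \<open>simple_extension_inverse_descends\<close>).
\<close>

section \<open>A divisibility criterion for pseudo-valuation domains\<close>

text \<open>Zorn's lemma, applied to the ideals that contain \<open>m\<close> but not \<open>\<one>\<close>.\<close>

lemma (in cring) nonunit_in_maximalideal: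
  assumes m: "m \<in> carrier R" "m \<notin> Units R"
  obtains I where "maximalideal I R" "m \<in> I"
proof -
  let ?A = "{I. ideal I R \<and> m \<in> I \<and> \<one> \<notin> I}"
  have "\<one> \<notin> PIdl m"
    using m unfolding cgenideal_def Units_def by (auto simp: m_comm)
  then have "PIdl m \<in> ?A"
    using m cgenideal_ideal cgenideal_self by auto
  moreover have "\<Union>C \<in> ?A" if C: "C \<noteq> {}" "subset.chain ?A C" for C
  proof -
    have "subset.chain {I. ideal I R} C"
      using C(2) unfolding pred_on.chain_def by blast
    from chain_Union_is_ideal[OF this] C show ?thesis
      by (auto simp: pred_on.chain_def)
  qed
  ultimately obtain I where I: "I \<in> ?A" and max: "\<And>J. J \<in> ?A \<Longrightarrow> I \<subseteq> J \<Longrightarrow> J = I"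
    using subset_Zorn_nonempty[of ?A] by (metis (lifting) empty_iff)
  have "maximalideal I R"
  proof (rule maximalidealI)
    show "ideal I R" using I by simp
    show "carrier R \<noteq> I" using I by auto
    fix J assume J: "ideal J R" "I \<subseteq> J" "J \<subseteq> carrier R"
    then show "J = I \<or> J = carrier R"
      using max[of J] I ideal.one_imp_carrier by blast
  qed
  with I that show thesis by blast
qed

text \<open>The criterion of Hedstrom and Houston without fractions: for \<open>x = a / b\<close> in the quotient
field and \<open>M\<close> the set of nonunits of \<open>D\<close>, either \<open>x \<in> D\<close> or \<open>x\<inverse> M \<subseteq> D\<close>.  Being first order in
the elements of \<open>D\<close>, it can be compared across different subrings of one domain without ever
identifying their quotient fields.\<close>

definition pseudo_valuative :: "('a, 'm) ring_scheme \<Rightarrow> bool" where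
  "pseudo_valuative D \<longleftrightarrow>
     (\<forall>a \<in> carrier D. \<forall>b \<in> carrier D. \<forall>m \<in> carrier D.
        b divides\<^bsub>D\<^esub> a \<or> a divides\<^bsub>D\<^esub> (b \<otimes>\<^bsub>D\<^esub> m) \<or> m \<in> Units D)"

lemma (in ring) ideal_subringI:
  assumes "subring D R" "I \<subseteq> D" "I \<noteq> {}"
    and "\<And>x y. x \<in> I \<Longrightarrow> y \<in> I \<Longrightarrow> x \<oplus> y \<in> I"
    and "\<And>x y. x \<in> I \<Longrightarrow> y \<in> D \<Longrightarrow> y \<otimes> x \<in> I"
    and "\<And>x y. x \<in> I \<Longrightarrow> y \<in> D \<Longrightarrow> x \<otimes> y \<in> I"
  shows "ideal I (R\<lparr>carrier := D\<rparr>)"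
proof (rule idealI)
  interpret D: ring "R\<lparr>carrier := D\<rparr>" by (rule subring_is_ring[OF assms(1)])
  show "ring (R\<lparr>carrier := D\<rparr>)" by (rule D.ring_axioms)
  have neg: "\<ominus>\<^bsub>R\<lparr>carrier := D\<rparr>\<^esub> x \<in> I" if "x \<in> I" for x
  proof -
    have x: "x \<in> D" using that assms(2) by blast
    have "\<ominus>\<^bsub>R\<lparr>carrier := D\<rparr>\<^esub> x = \<ominus>\<^bsub>R\<lparr>carrier := D\<rparr>\<^esub> \<one> \<otimes> x"
      using x D.l_minus[of \<one> x] subringE(3)[OF assms(1)] D.l_one[of x] by simp
    moreover have "\<ominus>\<^bsub>R\<lparr>carrier := D\<rparr>\<^esub> \<one> \<in> D"
      using D.a_inv_closed[of \<one>] subringE(3)[OF assms(1)] by simp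
    ultimately show ?thesis using assms(5) that by simp
  qed
  show "subgroup I (add_monoid (R\<lparr>carrier := D\<rparr>))"
    using assms neg by (intro D.add.subgroupI) (auto simp: a_inv_def)
qed (use assms in auto)


lemma (in cring) Units_subring:
  assumes "subring D R"
  shows "x \<in> Units (R\<lparr>carrier := D\<rparr>) \<longleftrightarrow> x \<in> D \<and> (\<exists>c\<in>D. x \<otimes> c = \<one>)"
  using subringE(1)[OF assms] m_comm unfolding Units_def by auto (metis subsetD)

lemma (in domain) pseudo_valuative_subring:
  assumes "subring D R"
  shows "pseudo_valuative (R\<lparr>carrier := D\<rparr>) \<longleftrightarrow>
    (\<forall>a\<in>D. \<forall>b\<in>D. \<forall>m\<in>D. (\<exists>c\<in>D. a = b \<otimes> c) \<or> (\<exists>c\<in>D. b \<otimes> m = a \<otimes> c) \<or> (\<exists>c\<in>D. m \<otimes> c = \<one>))"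
  unfolding pseudo_valuative_def factor_def
  by (auto simp: Units_subring[OF assms]) 

text \<open>The criterion makes \<open>D\<close> local.  If \<open>m\<close> and \<open>n\<close> are nonunits and one divides the other, it
divides the sum; otherwise the criterion applied to the pair \<open>(n, m)\<close> and the nonunit \<open>m\<close> says
that \<open>n\<close> divides \<open>m\<^sup>2\<close>.\<close>

lemma (in domain) pseudo_valuative_nonunits_add:
  assumes pv: "pseudo_valuative R" and m: "m \<in> carrier R" "m \<notin> Units R" and n: "n \<in> carrier R" "n \<notin> Units R"
  shows "m \<oplus> n \<notin> Units R"
proof
  assume U: "m \<oplus> n \<in> Units R"
  define u where "u = inv (m \<oplus> n)"
  have u: "u \<in> carrier R" "(m \<oplus> n) \<otimes> u = \<one>" using U by (auto simp: u_def)
  have nonunit: "x \<otimes> y \<noteq> \<one>" if "x = m \<or> x = n" "y \<in> carrier R" for x y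
    using that m n m_comm unfolding Units_def by auto
  consider "m divides n" | "n divides m" | "n divides (m \<otimes> m)"
    using pv m n unfolding pseudo_valuative_def by blast
  then show False
  proof cases
    case 1
    then obtain c where c: "c \<in> carrier R" "n = m \<otimes> c" by (auto simp: factor_def)
    have "m \<otimes> ((\<one> \<oplus> c) \<otimes> u) = (m \<oplus> n) \<otimes> u" using c u m by (simp add: m_assoc[symmetric] r_distr)
    then show ?thesis using nonunit[of m "(\<one> \<oplus> c) \<otimes> u"] u c by simp
  next
    case 2
    then obtain c where c: "c \<in> carrier R" "m = n \<otimes> c" by (auto simp: factor_def)
    have "n \<otimes> ((c \<oplus> \<one>) \<otimes> u) = (m \<oplus> n) \<otimes> u" using c u n by (simp add: m_assoc[symmetric] r_distr)
    then show ?thesis using nonunit[of n "(c \<oplus> \<one>) \<otimes> u"] u c by simp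
  next
    case 3
    then obtain c where c: "c \<in> carrier R" "m \<otimes> m = n \<otimes> c" by (auto simp: factor_def)
    \<comment> \<open>With \<open>m \<oplus> n\<close> invertible, \<open>m\<close> is a unit modulo \<open>n\<close>; but \<open>n\<close> divides \<open>m\<^sup>2\<close>, so it divides
      \<open>(m \<oplus> n)\<^sup>2\<close> and is a unit.\<close>
    have "n \<otimes> ((c \<oplus> m \<oplus> m \<oplus> n) \<otimes> u \<otimes> u) = ((m \<oplus> n) \<otimes> u) \<otimes> ((m \<oplus> n) \<otimes> u)"
    proof -
      have "n \<otimes> (c \<oplus> m \<oplus> m \<oplus> n) = m \<otimes> m \<oplus> n \<otimes> m \<oplus> n \<otimes> m \<oplus> n \<otimes> n"
        using c m n by (simp add: r_distr)
      also have "\<dots> = (m \<oplus> n) \<otimes> (m \<oplus> n)"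
        using m n by (simp add: r_distr l_distr a_ac m_comm)
      finally have "n \<otimes> (c \<oplus> m \<oplus> m \<oplus> n) \<otimes> (u \<otimes> u) = (m \<oplus> n) \<otimes> (m \<oplus> n) \<otimes> (u \<otimes> u)"
        by simp
      then show ?thesis using c u(1) m n by (simp add: m_assoc) (simp add: m_lcomm)
    qed
    then show ?thesis using nonunit[of n "(c \<oplus> m \<oplus> m \<oplus> n) \<otimes> u \<otimes> u"] u c m n by simp
  qed
qed

lemma (in domain) pseudo_valuative_subring_cases [consumes 5]:
  assumes "subring D R" "pseudo_valuative (R\<lparr>carrier := D\<rparr>)" "a \<in> D" "b \<in> D" "m \<in> D"
  obtains (divides) c where "c \<in> D" "a = b \<otimes> c"
    | (divides_mult) c where "c \<in> D" "b \<otimes> m = a \<otimes> c"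
    | (unit) c where "c \<in> D" "m \<otimes> c = \<one>"
  using assms(2-5) unfolding pseudo_valuative_subring[OF assms(1)] by blast

lemma (in domain) pseudo_valuative_subring_nonunits_ideal:
  assumes D: "subring D R" and pv: "pseudo_valuative (R\<lparr>carrier := D\<rparr>)"
  shows "ideal (D - Units (R\<lparr>carrier := D\<rparr>)) (R\<lparr>carrier := D\<rparr>)"
proof -
  interpret D: domain "R\<lparr>carrier := D\<rparr>" by (rule subring_is_domain[OF D])
  let ?M = "D - Units (R\<lparr>carrier := D\<rparr>)"
  have absorb: "y \<otimes> x \<in> ?M" if x: "x \<in> ?M" and y: "y \<in> D" for x y
  proof -
    have "y \<otimes> x \<notin> Units (R\<lparr>carrier := D\<rparr>)"
      using D.prod_unit_r[of y x] x y D.unit_factor[of x y] D.m_comm[of x y] by auto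
    then show ?thesis using subringE(6)[OF D] x y by auto
  qed
  show ?thesis
  proof (rule ideal_subringI[OF D])
    have "\<zero> \<in> ?M" using subringE[OF D] by (auto simp: Units_subring[OF D])
    then show "?M \<noteq> {}" by blast
    show "x \<oplus> y \<in> ?M" if "x \<in> ?M" "y \<in> ?M" for x y
      using D.pseudo_valuative_nonunits_add[OF pv, of x y] that subringE(7)[OF D] by auto
    show "y \<otimes> x \<in> ?M" "x \<otimes> y \<in> ?M" if "x \<in> ?M" "y \<in> D" for x y
      using absorb[OF that] D.m_comm[of x y] that by auto
  qed auto
qed

context field
begin

text \<open>A valuation ring is local: of two nonzero nonunits one is a multiple of the other, hence so is
their sum.\<close>

lemma valuation_ring_nonunits_prime:
  assumes V: "valuation_ring V R"
  shows "V - Units (R\<lparr>carrier := V\<rparr>) \<in> Spec (R\<lparr>carrier := V\<rparr>)"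
proof -
  let ?M = "V - Units (R\<lparr>carrier := V\<rparr>)"
  have sub: "subring V R" and val: "\<And>x. x \<in> carrier R \<Longrightarrow> x \<noteq> \<zero> \<Longrightarrow> x \<in> V \<or> inv x \<in> V"
    using V by (auto simp: valuation_ring_def)
  note V = subringE[OF sub]
  have VR: "x \<in> carrier R" if "x \<in> V" for x using V(1) that by blast
  have M: "x \<in> ?M \<longleftrightarrow> x \<in> V \<and> (\<forall>c\<in>V. x \<otimes> c \<noteq> \<one>)" for x
    by (auto simp: Units_subring[OF sub])
  have absorb: "y \<otimes> x \<in> ?M" if x: "x \<in> ?M" and y: "y \<in> V" for x y
    unfolding M
  proof (intro conjI ballI notI)
    show "y \<otimes> x \<in> V" using x y V by auto
    fix c assume c: "c \<in> V" "y \<otimes> x \<otimes> c = \<one>"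
    then have "x \<otimes> (y \<otimes> c) = \<one>" using x y VR by (simp add: m_ac)
    then show False using x c y V(6) unfolding M by blast
  qed
  have add: "x \<oplus> y \<in> ?M" if xy: "x \<in> ?M" "y \<in> ?M" "y \<noteq> \<zero>" "x \<otimes> inv y \<in> V" for x y
  proof -
    have y: "y \<in> carrier R" "inv y \<in> carrier R" "y \<otimes> inv y = \<one>" "x \<in> carrier R"
      using xy VR by (auto simp: field_Units)
    have "x \<oplus> y = (x \<otimes> inv y \<oplus> \<one>) \<otimes> y" using y by (simp add: l_distr) (simp add: m_ac)
    then show ?thesis using absorb[OF xy(2), of "x \<otimes> inv y \<oplus> \<one>"] xy(4) V by simp
  qed
  have zero: "\<zero> \<in> ?M" unfolding M using V VR by auto
  have "primeideal ?M (R\<lparr>carrier := V\<rparr>)"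
  proof (rule primeidealI)
    show "ideal ?M (R\<lparr>carrier := V\<rparr>)"
    proof (rule ideal_subringI[OF sub])
      fix x y assume xy: "x \<in> ?M" "y \<in> ?M"
      then have c: "x \<in> carrier R" "y \<in> carrier R" using VR by auto
      show "x \<oplus> y \<in> ?M"
      proof (cases "x = \<zero> \<or> y = \<zero>")
        case True then show ?thesis using xy c by auto
      next
        case False
        then have i: "inv x \<in> carrier R" "inv y \<in> carrier R" "x \<otimes> inv x = \<one>" "y \<otimes> inv y = \<one>"
          using c by (auto simp: field_Units)
        have "(x \<otimes> inv y) \<otimes> (y \<otimes> inv x) = (x \<otimes> inv x) \<otimes> (y \<otimes> inv y)"
          using i(1,2) c by (simp add: m_ac)
        then have "(x \<otimes> inv y) \<otimes> (y \<otimes> inv x) = \<one>" using i by simp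
        then have "inv (x \<otimes> inv y) = y \<otimes> inv x" "x \<otimes> inv y \<noteq> \<zero>" using i(1,2) c
          by (auto intro: comm_inv_char)
        then have "x \<otimes> inv y \<in> V \<or> y \<otimes> inv x \<in> V" using val[of "x \<otimes> inv y"] i c by auto
        then show ?thesis using add[of x y] add[of y x] xy False a_comm[OF c] by auto
      qed
    qed (use zero absorb VR m_comm in auto)
    show "cring (R\<lparr>carrier := V\<rparr>)"
      using subring_is_domain[OF sub] by (simp add: domain_def)
    have "\<one> \<notin> ?M" using V(3) VR unfolding M by auto
    then show "carrier (R\<lparr>carrier := V\<rparr>) \<noteq> ?M" using V(3) by auto
    fix a b assume ab: "a \<in> carrier (R\<lparr>carrier := V\<rparr>)" "b \<in> carrier (R\<lparr>carrier := V\<rparr>)"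
      "a \<otimes>\<^bsub>R\<lparr>carrier := V\<rparr>\<^esub> b \<in> ?M"
    show "a \<in> ?M \<or> b \<in> ?M"
    proof (rule ccontr)
      assume "\<not> ?thesis"
      then obtain c d where cd: "c \<in> V" "d \<in> V" "a \<otimes> c = \<one>" "b \<otimes> d = \<one>"
        using ab M[of a] M[of b] by auto
      have "(a \<otimes> b) \<otimes> (c \<otimes> d) = (a \<otimes> c) \<otimes> (b \<otimes> d)" using cd(1,2) ab VR by (simp add: m_ac)
      then show False using cd ab M V(6) by auto
    qed
  qed
  then show ?thesis by (simp add: Spec_def)
qed

text \<open>The maximal ideal \<open>N\<close> of \<open>V\<close> is a prime ideal of \<open>D\<close>, in particular a subset of \<open>D\<close>.  It contains
every nonunit \<open>m\<close> of \<open>D\<close>: a maximal ideal of \<open>D\<close> through \<open>m\<close> is a proper ideal of \<open>V\<close>.  So if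
\<open>inv x \<in> V\<close>, then \<open>inv x \<otimes> m \<in> N \<subseteq> D\<close>; and if not, \<open>x\<close> would itself lie in \<open>N \<subseteq> D\<close>.\<close>

lemma strongly_prime_of_equal_spectrum:
  assumes V: "valuation_ring V R" and D: "subring D R" "D \<subseteq> V"
    and Spec: "Spec (R\<lparr>carrier := D\<rparr>) = Spec (R\<lparr>carrier := V\<rparr>)"
    and x: "x \<in> carrier R" "x \<noteq> \<zero>" "x \<notin> D" and m: "m \<in> D" "m \<notin> Units (R\<lparr>carrier := D\<rparr>)"
  shows "inv x \<otimes> m \<in> D"
proof -
  let ?D = "R\<lparr>carrier := D\<rparr>" and ?V = "R\<lparr>carrier := V\<rparr>"
  have sub: "subring V R" and val: "\<And>x. x \<in> carrier R \<Longrightarrow> x \<noteq> \<zero> \<Longrightarrow> x \<in> V \<or> inv x \<in> V"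
    using V by (auto simp: valuation_ring_def)
  interpret D: cring ?D using subring_is_domain[OF D(1)] by (simp add: domain_def)
  let ?M = "V - Units ?V"
  have M: "primeideal ?M ?V" "?M \<subseteq> D"
  proof -
    show "primeideal ?M ?V" using valuation_ring_nonunits_prime[OF V] by (simp add: Spec_def)
    have "primeideal ?M ?D" using valuation_ring_nonunits_prime[OF V] unfolding Spec[symmetric] by (simp add: Spec_def)
    then show "?M \<subseteq> D"
      using ideal.Icarr[of ?M ?D] by (auto simp: primeideal_def)
  qed
  have "m \<notin> Units ?V"
  proof
    assume "m \<in> Units ?V"
    then obtain c where c: "c \<in> V" "m \<otimes> c = \<one>" by (auto simp: Units_subring[OF sub])
    obtain I where I: "maximalideal I ?D" "m \<in> I" using D.nonunit_in_maximalideal m by auto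
    then have "primeideal I ?V" using D.maximalideal_prime Spec by (auto simp: Spec_def)
    then interpret I: primeideal I ?V .
    have "\<one> \<in> I" using I.I_r_closed[OF I(2), of c] c by simp
    then show False using I.one_imp_carrier I.I_notcarr by simp
  qed
  then have m': "m \<in> ?M" using m D by auto
  show ?thesis
  proof (cases "inv x \<in> V")
    case True
    interpret M: primeideal ?M ?V by (rule M(1))
    show ?thesis using M.I_l_closed[OF m', of "inv x"] True M(2) by auto
  next
    case False
    then have "x \<in> V" using val x by blast
    moreover have "x \<notin> Units ?V"
    proof
      assume "x \<in> Units ?V"
      then obtain c where c: "c \<in> V" "x \<otimes> c = \<one>" by (auto simp: Units_subring[OF sub])
      then have "inv x = c" using x subringE(1)[OF sub] by (auto intro: comm_inv_char)
      then show False using False c by simp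
    qed
    ultimately show ?thesis using M(2) x by auto
  qed
qed

text \<open>The valuation ring is \<open>V = (M : M)\<close>, where \<open>M\<close> is the ideal of nonunits of \<open>D\<close>.  Elements of \<open>V\<close>
outside \<open>M\<close> are units of \<open>V\<close>, so proper ideals of either ring lie in \<open>M\<close>.  A prime ideal \<open>P\<close> of \<open>D\<close>
is an ideal of \<open>V\<close>: for \<open>v \<in> V\<close> and \<open>p \<in> P\<close>, both \<open>v p\<close> and \<open>v\<^sup>2 p\<close> lie in \<open>M \<subseteq> D\<close>, so
\<open>(v p)\<^sup>2 = (v\<^sup>2 p) p\<close> lies in \<open>P\<close>, and hence so does \<open>v p\<close>.\<close>

lemma equal_spectrum_valuation_ring_exists:
  assumes D: "subring D R" and pv: "pseudo_valuative (R\<lparr>carrier := D\<rparr>)"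
    and quot: "\<And>x. x \<in> carrier R \<Longrightarrow> \<exists>a\<in>D. \<exists>b\<in>D - {\<zero>}. x \<otimes> b = a"
  shows "\<exists>V. valuation_ring V R \<and> D \<subseteq> V \<and> Spec (R\<lparr>carrier := D\<rparr>) = Spec (R\<lparr>carrier := V\<rparr>)"
proof -
  let ?D = "R\<lparr>carrier := D\<rparr>"
  interpret D: domain ?D by (rule subring_is_domain[OF D])
  let ?M = "D - Units ?D"
  define V where "V = {x \<in> carrier R. \<forall>m\<in>?M. x \<otimes> m \<in> ?M}"
  let ?V = "R\<lparr>carrier := V\<rparr>"
  note DE = subringE[OF D]
  have DR: "x \<in> carrier R" if "x \<in> D" for x using DE(1) that by blast
  have M: "x \<in> ?M \<longleftrightarrow> x \<in> D \<and> (\<forall>c\<in>D. x \<otimes> c \<noteq> \<one>)" for x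
    by (auto simp: Units_subring[OF D])
  have MR: "x \<in> carrier R" if "x \<in> ?M" for x using that DR by blast
  have M_ideal: "ideal ?M ?D" by (rule pseudo_valuative_subring_nonunits_ideal[OF D pv])
  have Madd: "x \<oplus> y \<in> ?M" if "x \<in> ?M" "y \<in> ?M" for x y
    using additive_subgroup.a_closed[OF ideal.axioms(1)[OF M_ideal] that] by simp
  have Mmult: "y \<otimes> x \<in> ?M" if "x \<in> ?M" "y \<in> D" for x y
    using ideal.I_l_closed[OF M_ideal that(1), of y] that(2) by simp
  have Mneg: "\<ominus> x \<in> ?M" if "x \<in> ?M" for x
    using Mmult[OF that, of "\<ominus> \<one>"] DE MR[OF that] by (simp add: l_minus)
  have DV: "D \<subseteq> V" using Mmult DR by (auto simp: V_def)
  have VM: "x \<otimes> m \<in> ?M" if "x \<in> V" "m \<in> ?M" for x m using that by (auto simp: V_def)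
  have VR: "x \<in> carrier R" if "x \<in> V" for x using that by (auto simp: V_def)
  have sub: "subring V R"
  proof (rule subringI)
    show "\<one> \<in> V" using DV DE by auto
    fix x assume x: "x \<in> V"
    show "\<ominus> x \<in> V" unfolding V_def
    proof (intro CollectI conjI ballI)
      fix m assume m: "m \<in> ?M"
      show "\<ominus> x \<otimes> m \<in> ?M" using Mneg[OF VM[OF x m]] l_minus VR[OF x] MR[OF m] by simp
    qed (use VR x in auto)
    fix y assume y: "y \<in> V"
    show "x \<otimes> y \<in> V" unfolding V_def
    proof (intro CollectI conjI ballI)
      fix m assume m: "m \<in> ?M"
      show "x \<otimes> y \<otimes> m \<in> ?M"
        using VM[OF x VM[OF y m]] VR[OF x] VR[OF y] MR[OF m] by (simp add: m_assoc)
    qed (use VR x y in auto)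
    show "x \<oplus> y \<in> V" unfolding V_def
    proof (intro CollectI conjI ballI)
      fix m assume m: "m \<in> ?M"
      show "(x \<oplus> y) \<otimes> m \<in> ?M"
        using Madd[OF VM[OF x m] VM[OF y m]] VR[OF x] VR[OF y] MR[OF m] by (simp add: l_distr)
    qed (use VR x y in auto)
  qed (auto simp: V_def)
  \<comment> \<open>For \<open>x\<close> outside \<open>D\<close>, the first alternative of the criterion fails for every fraction
    \<open>a / b\<close> that represents \<open>x\<close>.\<close>
  have outside: "inv x \<in> V" if x: "x \<in> carrier R" "x \<notin> D" for x
  proof -
    have x0: "x \<noteq> \<zero>" using x DE by auto
    have i: "inv x \<in> carrier R" "x \<otimes> inv x = \<one>" using x x0 by (auto simp: field_Units)
    show ?thesis unfolding V_def
    proof (intro CollectI conjI ballI)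
      show "inv x \<in> carrier R" by fact
      fix m assume m: "m \<in> ?M"
      obtain a b where ab: "a \<in> D" "b \<in> D" "b \<noteq> \<zero>" "x \<otimes> b = a" using quot[OF x(1)] by auto
      have R: "a \<in> carrier R" "b \<in> carrier R" "m \<in> carrier R" using ab DR m by auto
      have "\<not> (\<exists>c\<in>D. a = b \<otimes> c)"
      proof
        assume "\<exists>c\<in>D. a = b \<otimes> c"
        then obtain c where c: "c \<in> D" "x \<otimes> b = c \<otimes> b" using ab DR m_comm by auto
        then have "x = c" using m_rcancel[of b x c] ab x DR R by auto
        then show False using c x by simp
      qed
      then obtain c where c: "c \<in> D" "b \<otimes> m = a \<otimes> c"
        using pv ab m unfolding pseudo_valuative_subring[OF D] M by blast
      have "b \<otimes> m = b \<otimes> (x \<otimes> c)" unfolding c using ab(4)[symmetric] R x DR c by (simp add: m_ac)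
      then have mxc: "m = x \<otimes> c" using m_lcancel[of b m "x \<otimes> c"] ab x DR R c by auto
      have "inv x \<otimes> m = (x \<otimes> inv x) \<otimes> c" unfolding mxc using i(1) x DR[OF c(1)] by (simp add: m_ac)
      then have eq: "inv x \<otimes> m = c" using i c DR by simp
      have "c \<otimes> d \<noteq> \<one>" if d: "d \<in> D" for d
      proof
        assume *: "c \<otimes> d = \<one>"
        have "m \<otimes> d = x \<otimes> (c \<otimes> d)" unfolding mxc using x DR c d by (simp add: m_ac)
        then have "x = m \<otimes> d" using * x by simp
        then show False using x d m DE by auto
      qed
      then show "inv x \<otimes> m \<in> ?M" unfolding eq M using c by blast
    qed
  qed
  have val: "valuation_ring V R"
    using sub outside DV by (auto simp: valuation_ring_def)
  have units: "inv x \<in> V \<and> x \<noteq> \<zero>" if x: "x \<in> V" "x \<notin> ?M" for x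
  proof (cases "x \<in> D")
    case True
    then obtain c where c: "c \<in> D" "x \<otimes> c = \<one>" using x M[of x] by blast
    then have "inv x = c" using True DR by (auto intro: comm_inv_char)
    then show ?thesis using c DV DR True by auto
  next
    case False
    then show ?thesis using outside[OF VR[OF x(1)]] DE by auto
  qed
  have unitinv: "x \<otimes> inv x = \<one>" if "x \<in> V" "x \<notin> ?M" for x
    using units[OF that] VR[OF that(1)] by (auto simp: field_Units)
  have below: "P \<subseteq> ?M" if P: "ideal P (R\<lparr>carrier := A\<rparr>)" "A \<noteq> P" "A = D \<or> A = V" for P A
  proof
    fix p assume p: "p \<in> P"
    interpret P: ideal P "R\<lparr>carrier := A\<rparr>" by fact
    have one: "\<one> \<notin> P" using P.one_imp_carrier P(2) by auto
    have pA: "p \<in> A" using P.Icarr[OF p] by simp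
    show "p \<in> ?M"
    proof (rule ccontr)
      assume np: "p \<notin> ?M"
      have "\<exists>c\<in>A. p \<otimes> c = \<one>"
      proof (cases "A = D")
        case True then show ?thesis using pA np M by auto
      next
        case False then show ?thesis using pA np units unitinv P(3) by auto
      qed
      then show False using P.I_r_closed[OF p] one by fastforce
    qed
  qed
  have "primeideal P ?D \<longleftrightarrow> primeideal P ?V" for P
  proof
    assume P: "primeideal P ?D"
    interpret P: primeideal P ?D by fact
    have PM: "P \<subseteq> ?M" using below[OF P.is_ideal] P.I_notcarr by auto
    have PV: "v \<otimes> p \<in> P" if v: "v \<in> V" and p: "p \<in> P" for v p
    proof -
      have R: "v \<in> carrier R" "p \<in> carrier R" using VR v p PM MR by auto
      have 1: "v \<otimes> p \<in> ?M" using VM v p PM by auto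
      have 2: "v \<otimes> (v \<otimes> p) \<in> ?M" using VM[OF v 1] .
      have "(v \<otimes> p) \<otimes> (v \<otimes> p) = (v \<otimes> (v \<otimes> p)) \<otimes> p" using R by (simp add: m_ac)
      then have "(v \<otimes> p) \<otimes> (v \<otimes> p) \<in> P" using P.I_l_closed[OF p, of "v \<otimes> (v \<otimes> p)"] 2 by auto
      then show ?thesis using P.I_prime[of "v \<otimes> p" "v \<otimes> p"] 1 by auto
    qed
    show "primeideal P ?V"
    proof (rule primeidealI)
      show "ideal P ?V"
      proof (rule ideal_subringI[OF sub])
        show "P \<subseteq> V" using PM DV by auto
        show "P \<noteq> {}" using additive_subgroup.zero_closed[OF ideal.axioms(1)[OF P.is_ideal]] by auto
        fix x y assume x: "x \<in> P"
        show "y \<in> P \<Longrightarrow> x \<oplus> y \<in> P"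
          using additive_subgroup.a_closed[OF ideal.axioms(1)[OF P.is_ideal] x, of y] by simp
        assume y: "y \<in> V"
        show "y \<otimes> x \<in> P" using PV[OF y x] .
        moreover have "x \<in> carrier R" using x PM MR by blast
        ultimately show "x \<otimes> y \<in> P" using m_comm[of x y] VR[OF y] by simp
      qed
      show "cring ?V" using subring_is_domain[OF sub] by (simp add: domain_def)
      have "\<one> \<notin> P" using P.one_imp_carrier P.I_notcarr by auto
      then show "carrier ?V \<noteq> P" using subringE(3)[OF sub] by auto
      fix a b assume ab: "a \<in> carrier ?V" "b \<in> carrier ?V" "a \<otimes>\<^bsub>?V\<^esub> b \<in> P"
      have R: "a \<in> carrier R" "b \<in> carrier R" using ab VR by auto
      consider "a \<in> ?M" "b \<in> ?M" | "a \<notin> ?M" | "b \<notin> ?M" by blast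
      then show "a \<in> P \<or> b \<in> P"
      proof cases
        case 1 then show ?thesis using P.I_prime[of a b] ab by auto
      next
        case 2
        then have i: "inv a \<in> V" "a \<otimes> inv a = \<one>" using units unitinv ab by auto
        have "inv a \<otimes> (a \<otimes> b) = (a \<otimes> inv a) \<otimes> b" using i(1) VR R by (simp add: m_ac)
        then show ?thesis using PV[OF i(1), of "a \<otimes> b"] ab i R by simp
      next
        case 3
        then have i: "inv b \<in> V" "b \<otimes> inv b = \<one>" using units unitinv ab by auto
        have "inv b \<otimes> (a \<otimes> b) = a \<otimes> (b \<otimes> inv b)" using i(1) VR R by (simp add: m_ac)
        then show ?thesis using PV[OF i(1), of "a \<otimes> b"] ab i R by simp
      qed
    qed
  next
    assume P: "primeideal P ?V"
    interpret P: primeideal P ?V by fact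
    have PM: "P \<subseteq> ?M" using below[OF P.is_ideal] P.I_notcarr by auto
    show "primeideal P ?D"
    proof (rule primeidealI)
      show "ideal P ?D"
      proof (rule ideal_subringI[OF D])
        show "P \<subseteq> D" using PM by auto
        show "P \<noteq> {}" using additive_subgroup.zero_closed[OF ideal.axioms(1)[OF P.is_ideal]] by auto
        fix x y assume x: "x \<in> P"
        show "y \<in> P \<Longrightarrow> x \<oplus> y \<in> P"
          using additive_subgroup.a_closed[OF ideal.axioms(1)[OF P.is_ideal] x, of y] by simp
        assume y: "y \<in> D"
        show "y \<otimes> x \<in> P" "x \<otimes> y \<in> P"
          using P.I_l_closed[OF x, of y] P.I_r_closed[OF x, of y] y DV by auto
      qed
      show "cring ?D" by (rule D.is_cring)
      have "\<one> \<notin> P" using P.one_imp_carrier P.I_notcarr by auto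
      then show "carrier ?D \<noteq> P" using DE(3) by auto
      fix a b assume ab: "a \<in> carrier ?D" "b \<in> carrier ?D" "a \<otimes>\<^bsub>?D\<^esub> b \<in> P"
      then show "a \<in> P \<or> b \<in> P" using P.I_prime[of a b] DV by auto
    qed
  qed
  then show ?thesis using val DV by (intro exI[of _ V]) (auto simp: Spec_def)
qed

end

text \<open>The two directions above, read in the quotient field, where \<open>D\<close> is its image under \<open>to_frac\<close>.\<close>

theorem (in domain) PVD_iff_pseudo_valuative: "PVD R \<longleftrightarrow> pseudo_valuative R"
proof -
  let ?K = "quotient_field R" and ?\<phi> = "to_frac R"
  interpret K: field ?K by (rule field_quotient_field)
  interpret \<phi>: ring_hom_ring R ?K ?\<phi>
    by (rule ring_hom_ringI2) (simp_all add: ring_axioms K.ring_axioms to_frac_hom)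
  let ?D = "?\<phi> ` carrier R"
  have D: "subring ?D ?K" by (rule \<phi>.img_is_subring[OF carrier_is_subring])
  have inj: "?\<phi> a = ?\<phi> b \<longleftrightarrow> a = b" if "a \<in> carrier R" "b \<in> carrier R" for a b
    using inj_on_to_frac that by (auto simp: inj_on_def)
  have div: "(\<exists>c\<in>?D. ?\<phi> a = ?\<phi> b \<otimes>\<^bsub>?K\<^esub> c) \<longleftrightarrow> b divides a"
    if "a \<in> carrier R" "b \<in> carrier R" for a b
    using that by (auto simp: factor_def inj \<phi>.hom_mult[symmetric] simp del: \<phi>.hom_mult)
  have unit: "?\<phi> m \<in> Units (?K\<lparr>carrier := ?D\<rparr>) \<longleftrightarrow> m \<in> Units R" if "m \<in> carrier R" for m
  proof -
    have "?\<phi> m \<in> Units (?K\<lparr>carrier := ?D\<rparr>) \<longleftrightarrow> (\<exists>c\<in>carrier R. ?\<phi> (m \<otimes> c) = ?\<phi> \<one>)"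
      using that by (auto simp: K.Units_subring[OF D])
    also have "\<dots> \<longleftrightarrow> (\<exists>c\<in>carrier R. m \<otimes> c = \<one>)" using that by (intro bex_cong inj) auto
    also have "\<dots> \<longleftrightarrow> m \<in> Units R" using that m_comm by (auto simp: Units_def)
    finally show ?thesis .
  qed
  have pv: "pseudo_valuative (?K\<lparr>carrier := ?D\<rparr>) \<longleftrightarrow> pseudo_valuative R"
  proof -
    have "(\<exists>c\<in>?D. ?\<phi> b \<otimes>\<^bsub>?K\<^esub> ?\<phi> m = ?\<phi> a \<otimes>\<^bsub>?K\<^esub> c) \<longleftrightarrow> a divides (b \<otimes> m)"
      if "a \<in> carrier R" "b \<in> carrier R" "m \<in> carrier R" for a b m
      using div[of "b \<otimes> m" a] that by simp
    moreover have "(\<exists>c\<in>?D. ?\<phi> m \<otimes>\<^bsub>?K\<^esub> c = \<one>\<^bsub>?K\<^esub>) \<longleftrightarrow> m \<in> Units R" if "m \<in> carrier R" for m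
      using unit[OF that] that by (simp add: K.Units_subring[OF D])
    ultimately show ?thesis
      unfolding K.pseudo_valuative_subring[OF D] unfolding pseudo_valuative_def ball_simps(9)
      using div by (simp cong: ball_cong)
  qed
  show ?thesis
  proof
    assume "PVD R"
    then obtain V where V: "overring V R" "valuation_ring V ?K"
      "Spec (?K\<lparr>carrier := ?D\<rparr>) = Spec (?K\<lparr>carrier := V\<rparr>)" by (auto simp: PVD_def)
    have DV: "?D \<subseteq> V" using V by (simp add: overring_def)
    show "pseudo_valuative R"
      unfolding pseudo_valuative_def
    proof (intro ballI, rule ccontr)
      fix a b m assume abm: "a \<in> carrier R" "b \<in> carrier R" "m \<in> carrier R"
        and *: "\<not> (b divides a \<or> a divides (b \<otimes> m) \<or> m \<in> Units R)"
      have "a \<noteq> \<zero>" using * abm by (auto simp: factor_def intro!: bexI[of _ \<zero>])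
      moreover have "b \<noteq> \<zero>" using * abm by (auto simp: factor_def intro!: bexI[of _ \<zero>])
      ultimately have nz: "?\<phi> a \<noteq> \<zero>\<^bsub>?K\<^esub>" "?\<phi> b \<noteq> \<zero>\<^bsub>?K\<^esub>" using inj[of _ \<zero>] abm by auto
      define x where "x = ?\<phi> a \<otimes>\<^bsub>?K\<^esub> inv\<^bsub>?K\<^esub> ?\<phi> b"
      define y where "y = ?\<phi> b \<otimes>\<^bsub>?K\<^esub> inv\<^bsub>?K\<^esub> ?\<phi> a"
      have i: "inv\<^bsub>?K\<^esub> ?\<phi> a \<in> carrier ?K" "inv\<^bsub>?K\<^esub> ?\<phi> b \<in> carrier ?K"
        "?\<phi> a \<otimes>\<^bsub>?K\<^esub> inv\<^bsub>?K\<^esub> ?\<phi> a = \<one>\<^bsub>?K\<^esub>" "?\<phi> b \<otimes>\<^bsub>?K\<^esub> inv\<^bsub>?K\<^esub> ?\<phi> b = \<one>\<^bsub>?K\<^esub>"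
        using nz abm by (auto simp: K.field_Units)
      have "?\<phi> b \<otimes>\<^bsub>?K\<^esub> x = ?\<phi> a \<otimes>\<^bsub>?K\<^esub> (?\<phi> b \<otimes>\<^bsub>?K\<^esub> inv\<^bsub>?K\<^esub> ?\<phi> b)"
        unfolding x_def using i(1,2) abm by (simp add: K.m_ac)
      then have bx: "?\<phi> a = ?\<phi> b \<otimes>\<^bsub>?K\<^esub> x" using i abm by simp
      have "?\<phi> a \<otimes>\<^bsub>?K\<^esub> y = ?\<phi> b \<otimes>\<^bsub>?K\<^esub> (?\<phi> a \<otimes>\<^bsub>?K\<^esub> inv\<^bsub>?K\<^esub> ?\<phi> a)"
        unfolding y_def using i(1,2) abm by (simp add: K.m_ac)
      then have ay: "?\<phi> b = ?\<phi> a \<otimes>\<^bsub>?K\<^esub> y" using i abm by simp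
      have xK: "x \<in> carrier ?K" "y \<in> carrier ?K" unfolding x_def y_def using i abm by auto
      have "x \<otimes>\<^bsub>?K\<^esub> y = (?\<phi> a \<otimes>\<^bsub>?K\<^esub> inv\<^bsub>?K\<^esub> ?\<phi> a) \<otimes>\<^bsub>?K\<^esub> (?\<phi> b \<otimes>\<^bsub>?K\<^esub> inv\<^bsub>?K\<^esub> ?\<phi> b)"
        unfolding x_def y_def using i(1,2) abm by (simp add: K.m_ac)
      then have xy: "inv\<^bsub>?K\<^esub> x = y" using i xK by (simp add: K.comm_inv_char)
      have "x \<notin> ?D" using div[of a b] bx * abm by blast
      moreover have "x \<noteq> \<zero>\<^bsub>?K\<^esub>" 
        using bx nz(1) K.r_null[OF \<phi>.hom_closed[OF abm(2)]] by metis
      ultimately have "y \<otimes>\<^bsub>?K\<^esub> ?\<phi> m \<in> ?D"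
        using K.strongly_prime_of_equal_spectrum[OF V(2) D DV V(3) xK(1), of "?\<phi> m"] abm unit[of m] * xy
        by auto
      moreover have "?\<phi> (b \<otimes> m) = ?\<phi> a \<otimes>\<^bsub>?K\<^esub> (y \<otimes>\<^bsub>?K\<^esub> ?\<phi> m)"
        using \<phi>.hom_mult[OF abm(2,3)] K.m_assoc[OF \<phi>.hom_closed[OF abm(1)] xK(2) \<phi>.hom_closed[OF abm(3)]]
        unfolding ay[symmetric] by simp
      ultimately show False using div[of "b \<otimes> m" a] abm * by blast
    qed
  next
    assume "pseudo_valuative R"
    moreover have "\<exists>a\<in>?D. \<exists>b\<in>?D - {\<zero>\<^bsub>?K\<^esub>}. x \<otimes>\<^bsub>?K\<^esub> b = a" if x: "x \<in> carrier ?K" for x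
    proof -
      obtain a b where ab: "x = fraction R a b" "a \<in> carrier R" "b \<in> carrier R" "b \<noteq> \<zero>"
        using frac_cases[OF x] .
      then have "x \<otimes>\<^bsub>?K\<^esub> ?\<phi> b = ?\<phi> a" using frac_eq_divide by simp
      moreover have "?\<phi> b \<noteq> \<zero>\<^bsub>?K\<^esub>" using inj[of b \<zero>] ab by simp
      ultimately show ?thesis using ab by blast
    qed
    ultimately obtain V where "valuation_ring V ?K" "?D \<subseteq> V"
      "Spec (?K\<lparr>carrier := ?D\<rparr>) = Spec (?K\<lparr>carrier := V\<rparr>)"
      using K.equal_spectrum_valuation_ring_exists[OF D] pv by blast
    then show "PVD R"
      unfolding PVD_def overring_def by (auto simp: valuation_ring_def domain_axioms)
  qed
qed

section \<open>Local simple extensions\<close>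

text \<open>If \<open>D[s]\<close> is local, \<open>s\<close> cannot be transcendental modulo \<open>M\<close>, since a polynomial ring in \<open>s\<close> has
the two nonunits \<open>s\<close> and \<open>\<one> \<ominus> s\<close> with sum \<open>\<one>\<close>.  So one of them is a unit.  The point is to turn an
inverse \<open>p\<close> of \<open>\<one> \<ominus> s\<close> into a relation whose constant coefficient is not in \<open>M\<close>: in
\<open>(\<one> \<ominus> s) p \<equiv> c\<close> with \<open>p = q s \<oplus> k\<close>, either \<open>k \<ominus> c\<close> is such a coefficient, or \<open>k \<equiv> c\<close> and cancelling
\<open>s\<close> leaves \<open>(\<one> \<ominus> s) q \<equiv> k\<close>, with \<open>q\<close> of smaller degree.  The lemma serves with \<open>M\<close> the maximal
ideal of \<open>D\<close> and with \<open>M = {\<zero>}\<close>.\<close>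

lemma (in domain) nontrivial_relation_of_local_simple_extension:
  assumes D: "subring D R" and s: "s \<in> carrier R"
    and pv: "pseudo_valuative (R\<lparr>carrier := simple_extension D s\<rparr>)"
    and M: "ideal M (R\<lparr>carrier := D\<rparr>)" "\<one> \<notin> M"
    and cancel: "\<And>x. x \<in> carrier R \<Longrightarrow> s \<otimes> x \<in> M \<Longrightarrow> x \<in> M"
  shows "\<exists>d\<in>D - M. \<exists>e\<in>simple_extension D s. d \<oplus> s \<otimes> e \<in> M"
proof -
  let ?E = "simple_extension D s"
  note DE = subringE[OF D]
  interpret M: ideal M "R\<lparr>carrier := D\<rparr>" by fact
  have E: "subring ?E R" by (rule simple_extension_is_subring[OF D s])
  note EE = subringE[OF E]
  interpret E: domain "R\<lparr>carrier := ?E\<rparr>" by (rule subring_is_domain[OF E])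
  have DE': "D \<subseteq> ?E" by (rule simple_extension_incl[OF DE(1) s])
  have sE: "s \<in> ?E" by (rule simple_extension_mem[OF D s])
  have MD: "M \<subseteq> D" using M.Icarr by auto
  have DR: "x \<in> carrier R" if "x \<in> D" for x using DE(1) that by blast
  have ER: "x \<in> carrier R" if "x \<in> ?E" for x using EE(1) that by blast
  have Madd: "x \<oplus> y \<in> M" if "x \<in> M" "y \<in> M" for x y
    using additive_subgroup.a_closed[OF M.additive_subgroup_axioms that] by simp
  have Mneg: "\<ominus> x \<in> M" if "x \<in> M" for x
  proof -
    have "x \<in> carrier R" using that MD DE(1) by blast
    then show ?thesis using M.I_l_closed[OF that, of "\<ominus> \<one>"] DE(3,5) by (simp add: l_minus)
  qed
  have Mzero: "\<zero> \<in> M" using additive_subgroup.zero_closed[OF M.additive_subgroup_axioms] by simp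
  have relation: "\<exists>d\<in>D - M. \<exists>e\<in>?E. d \<oplus> s \<otimes> e \<in> M"
    if "p \<in> ?E" "c \<in> D - M" "(\<one> \<ominus> s) \<otimes> p \<ominus> c \<in> M" for p c
    using that
  proof (induction arbitrary: c rule: simple_extension.induct)
    case zero
    have "(\<one> \<ominus> s) \<otimes> \<zero> \<ominus> c = \<ominus> c" using zero s DR by (simp add: a_minus_def)
    then have "\<ominus> (\<ominus> c) \<in> M" using Mneg[of "\<ominus> c"] zero by simp
    then show ?case using zero DR by simp
  next
    case (lin q k)
    define w where "w = (\<one> \<ominus> s) \<otimes> q \<ominus> k"
    let ?\<mu> = "(\<one> \<ominus> s) \<otimes> (q \<otimes> s \<oplus> k) \<ominus> c"
    have R: "q \<in> carrier R" "k \<in> carrier R" "c \<in> carrier R" "w \<in> carrier R"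
      using lin ER DR s by (auto simp: w_def)
    have wE: "w \<in> ?E"
      unfolding w_def a_minus_def by (intro EE(3,5-7) lin(1) sE subsetD[OF DE' lin(2)])
    have eq: "?\<mu> = (k \<ominus> c) \<oplus> s \<otimes> w"
      unfolding w_def using R s by (simp add: a_minus_def l_distr r_distr l_minus r_minus minus_add)
         (simp add: a_ac m_ac)
    have kcD: "k \<ominus> c \<in> D" using lin DE by (simp add: a_minus_def)
    show ?case
    proof (cases "k \<ominus> c \<in> M")
      case False
      then show ?thesis using lin(5) wE kcD unfolding eq by blast
    next
      case True
      have "s \<otimes> w = \<ominus> (k \<ominus> c) \<oplus> ((k \<ominus> c) \<oplus> s \<otimes> w)"
        using R s by (simp add: a_assoc[symmetric] l_neg)
      then have "s \<otimes> w \<in> M" using Madd[OF Mneg[OF True] lin(5)[unfolded eq]] by simp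
      then have w: "w \<in> M" by (rule cancel[OF R(4)])
      have "k \<notin> M"
      proof
        assume "k \<in> M"
        moreover have "\<ominus> (k \<ominus> c) \<oplus> k = c" using R by (simp add: a_minus_def minus_add a_ac r_neg)
        ultimately show False using Madd[OF Mneg[OF True], of k] lin(4) by simp
      qed
      then show ?thesis using lin.IH[of k] lin(2) w unfolding w_def by blast
    qed
  qed
  have "s \<in> Units (R\<lparr>carrier := ?E\<rparr>) \<or> \<one> \<ominus> s \<in> Units (R\<lparr>carrier := ?E\<rparr>)"
  proof (rule ccontr)
    assume "\<not> ?thesis"
    moreover have "\<one> \<ominus> s \<in> ?E" using EE sE by (simp add: a_minus_def)
    ultimately have "s \<oplus> (\<one> \<ominus> s) \<notin> Units (R\<lparr>carrier := ?E\<rparr>)"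
      using E.pseudo_valuative_nonunits_add[OF pv, of s "\<one> \<ominus> s"] sE by simp
    moreover have "s \<oplus> (\<one> \<ominus> s) = \<one>" using s by (simp add: a_minus_def a_lcomm[of s \<one>] r_neg)
    ultimately show False using E.Units_one_closed by simp
  qed
  then show ?thesis
  proof
    assume "s \<in> Units (R\<lparr>carrier := ?E\<rparr>)"
    then obtain c where c: "c \<in> ?E" "s \<otimes> c = \<one>" by (auto simp: Units_subring[OF E])
    then have "\<one> \<oplus> s \<otimes> \<ominus> c = \<zero>" using s ER by (simp add: r_minus r_neg)
    then show ?thesis using Mzero M(2) DE(3) EE(5)[OF c(1)] by (metis DiffI)
  next
    assume "\<one> \<ominus> s \<in> Units (R\<lparr>carrier := ?E\<rparr>)"
    then obtain p where p: "p \<in> ?E" "(\<one> \<ominus> s) \<otimes> p = \<one>" by (auto simp: Units_subring[OF E])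
    then show ?thesis using relation[OF p(1), of \<one>] M(2) DE(3) Mzero by (simp add: a_minus_def r_neg)
  qed
qed

text \<open>Take for \<open>M\<close> the maximal ideal of \<open>D\<close>.  In the relation \<open>d \<oplus> s \<otimes> e \<in> M\<close> the coefficient \<open>d\<close> is
then a unit of \<open>D\<close>, and so is \<open>s \<otimes> e\<close>, which differs from \<open>\<ominus> d\<close> by an element of \<open>M\<close>.\<close>

lemma (in domain) inverse_in_local_simple_extension:
  assumes D: "subring D R" and pvD: "pseudo_valuative (R\<lparr>carrier := D\<rparr>)"
    and s: "s \<in> carrier R" and pv: "pseudo_valuative (R\<lparr>carrier := simple_extension D s\<rparr>)"
    and cancel: "\<And>x. x \<in> carrier R \<Longrightarrow> s \<otimes> x \<in> D - Units (R\<lparr>carrier := D\<rparr>)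
      \<Longrightarrow> x \<in> D - Units (R\<lparr>carrier := D\<rparr>)"
  shows "\<exists>c\<in>simple_extension D s. s \<otimes> c = \<one>"
proof -
  let ?E = "simple_extension D s" and ?M = "D - Units (R\<lparr>carrier := D\<rparr>)"
  interpret D: domain "R\<lparr>carrier := D\<rparr>" by (rule subring_is_domain[OF D])
  note DE = subringE[OF D]
  have E: "subring ?E R" by (rule simple_extension_is_subring[OF D s])
  note EE = subringE[OF E]
  have M: "ideal ?M (R\<lparr>carrier := D\<rparr>)" by (rule pseudo_valuative_subring_nonunits_ideal[OF D pvD])
  interpret M: ideal ?M "R\<lparr>carrier := D\<rparr>" by fact
  have "\<one> \<notin> ?M" using D.Units_one_closed by simp
  from nontrivial_relation_of_local_simple_extension[OF D s pv M this cancel]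
  obtain d e where de: "d \<in> Units (R\<lparr>carrier := D\<rparr>)" "d \<in> D" "e \<in> ?E" "d \<oplus> s \<otimes> e \<in> ?M" by blast
  define u where "u = s \<otimes> e"
  have R: "d \<in> carrier R" "e \<in> carrier R" "u \<in> carrier R"
    using de(2,3) DE(1) EE(1) s by (auto simp: u_def)
  have ud: "u = (d \<oplus> u) \<oplus> \<ominus> d" using R by (simp add: a_comm[of d u] a_assoc r_neg)
  then have uD: "u \<in> D" using de DE unfolding u_def[symmetric] by (metis DiffE)
  have "u \<notin> ?M"
  proof
    assume "u \<in> ?M"
    then have "\<ominus> u \<in> ?M" using M.I_l_closed[of u "\<ominus> \<one>"] DE R by (auto simp: l_minus)
    then have "(d \<oplus> u) \<oplus> \<ominus> u \<in> ?M"
      using additive_subgroup.a_closed[OF M.additive_subgroup_axioms de(4)[folded u_def]] by simp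
    then show False using R de(1) by (simp add: a_assoc r_neg)
  qed
  then obtain v where v: "v \<in> D" "u \<otimes> v = \<one>" using uD by (auto simp: Units_subring[OF D])
  then have "s \<otimes> (e \<otimes> v) = \<one>" using R s DE(1) by (auto simp: u_def m_assoc)
  moreover have "e \<otimes> v \<in> ?E" using de(3) v simple_extension_incl[OF DE(1) s] EE by blast
  ultimately show ?thesis by blast
qed

section \<open>In a pair over a nonfield, the larger ring consists of fractions\<close>

definition (in ring) power_sum :: "'a \<Rightarrow> (nat \<Rightarrow> 'a) \<Rightarrow> nat \<Rightarrow> 'a" where
  "power_sum s f n = (\<Oplus>i\<in>{..n}. f i \<otimes> s [^] i)"

context cring
begin

context
  fixes s assumes s: "s \<in> carrier R"
begin

lemma power_sum_0: "f 0 \<in> carrier R \<Longrightarrow> power_sum s f 0 = f 0"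
  by (simp add: power_sum_def)

lemma power_sum_Suc:
  "range f \<subseteq> carrier R \<Longrightarrow> power_sum s f (Suc n) = power_sum s f n \<oplus> f (Suc n) \<otimes> s [^] Suc n"
  using s unfolding power_sum_def by (subst finsum_Suc) (auto simp: Pi_def image_subset_iff a_comm simp del: nat_pow_Suc)

lemma power_sum_closed [simp]: "range f \<subseteq> carrier R \<Longrightarrow> power_sum s f n \<in> carrier R"
  using s unfolding power_sum_def by (intro finsum_closed) (auto simp: image_subset_iff)

lemma power_sum_cong: "\<lbrakk>\<And>i. i \<le> n \<Longrightarrow> f i = g i; range g \<subseteq> carrier R\<rbrakk> \<Longrightarrow> power_sum s f n = power_sum s g n"
  using s unfolding power_sum_def by (intro finsum_cong') (auto simp: image_subset_iff)

lemma power_sum_add: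
  assumes "range f \<subseteq> carrier R" "range g \<subseteq> carrier R"
  shows "power_sum s (\<lambda>i. f i \<oplus> g i) n = power_sum s f n \<oplus> power_sum s g n"
  unfolding power_sum_def using assms s
  by (subst finsum_addf[symmetric]) (auto simp: image_subset_iff l_distr intro!: finsum_cong')

lemma power_sum_smult:
  assumes "c \<in> carrier R" "range f \<subseteq> carrier R"
  shows "power_sum s (\<lambda>i. c \<otimes> f i) n = c \<otimes> power_sum s f n"
  unfolding power_sum_def using assms s
  by (subst finsum_rdistr) (auto simp: image_subset_iff m_assoc intro!: finsum_cong')

lemma power_sum_shift:
  assumes "range f \<subseteq> carrier R" "k \<in> carrier R"
  shows "power_sum s (case_nat k f) (Suc n) = k \<oplus> s \<otimes> power_sum s f n"
proof (induction n)
  have r: "range (case_nat k f) \<subseteq> carrier R" using assms by (auto simp: image_subset_iff split: nat.splits)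
  {
    case 0
    show ?case using r assms s by (simp add: power_sum_Suc power_sum_0 m_comm image_subset_iff)
  next
    case (Suc n)
    have "power_sum s (case_nat k f) (Suc (Suc n))
        = k \<oplus> s \<otimes> power_sum s f n \<oplus> f (Suc n) \<otimes> s [^] Suc (Suc n)"
      by (subst power_sum_Suc[OF r]) (simp add: Suc del: nat_pow_Suc)
    also have "\<dots> = k \<oplus> s \<otimes> power_sum s f (Suc n)"
      using assms s by (simp add: power_sum_Suc r_distr a_assoc image_subset_iff) (simp add: m_ac)
    finally show ?case .
  }
qed

end

lemma simple_extension_power_sum:
  assumes D: "subring D R" and s: "s \<in> carrier R" and x: "x \<in> simple_extension D s"
  obtains f n where "range f \<subseteq> D" "x = power_sum s f n"
proof -
  note DE = subringE[OF D]
  have "\<exists>f n. range f \<subseteq> D \<and> x = power_sum s f n"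
    using x
  proof (induction rule: simple_extension.induct)
    case zero
    show ?case using DE by (intro exI[of _ "\<lambda>_. \<zero>"] exI[of _ 0]) (simp add: power_sum_0[OF s])
  next
    case (lin p k)
    then obtain f n where f: "range f \<subseteq> D" "p = power_sum s f n" by blast
    then have "p \<otimes> s \<oplus> k = power_sum s (case_nat k f) (Suc n)"
      using DE(1) lin(2) s power_sum_shift[OF s, of f k n] power_sum_closed[OF s, of f n]
      by (simp add: subset_trans m_comm a_comm subset_iff)
    moreover have "range (case_nat k f) \<subseteq> D" using f lin(2) by (auto simp: image_subset_iff split: nat.splits)
    ultimately show ?case by blast
  qed
  then show thesis using that by blast
qed

end


text \<open>A relation of least degree; below that degree the powers of \<open>s\<close> are linearly independent over
\<open>D\<close>.\<close>

lemma (in domain) least_power_relation: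
  assumes D: "subring D R" and s: "s \<in> carrier R"
    and f: "range f \<subseteq> D" "power_sum s f m = \<zero>" "f k \<noteq> \<zero>" "k \<le> m"
  obtains n h where "range h \<subseteq> D" "power_sum s h n = \<zero>" "h n \<noteq> \<zero>"
    and "\<And>g i. range g \<subseteq> D \<Longrightarrow> i < n \<Longrightarrow> power_sum s g i = \<zero> \<Longrightarrow> \<forall>j\<le>i. g j = \<zero>"
proof -
  define Rel where "Rel n \<longleftrightarrow> (\<exists>h. range h \<subseteq> D \<and> power_sum s h n = \<zero> \<and> h n \<noteq> \<zero>)" for n
  have DR: "range g \<subseteq> carrier R" if "range g \<subseteq> D" for g :: "nat \<Rightarrow> 'a"
    using that subringE(1)[OF D] by blast
  have truncate: "\<exists>n\<le>m. Rel n"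
    if "range g \<subseteq> D" "power_sum s g m = \<zero>" "g k \<noteq> \<zero>" "k \<le> m" for g m k
    using that
  proof (induction m)
    case 0
    then show ?case unfolding Rel_def by auto
  next
    case (Suc m)
    show ?case
    proof (cases "g (Suc m) = \<zero>")
      case False then show ?thesis using Suc.prems unfolding Rel_def by blast
    next
      case True
      then have "power_sum s g m = \<zero>"
        using Suc.prems power_sum_Suc[OF s DR[OF Suc.prems(1)], of m] s
          power_sum_closed[OF s DR[OF Suc.prems(1)], of m] by (simp del: nat_pow_Suc)
      moreover have "k \<le> m" using Suc.prems True by (cases "k = Suc m") auto
      ultimately show ?thesis using Suc.IH Suc.prems le_SucI by blast
    qed
  qed
  define n where "n = (LEAST n. Rel n)"
  have "Rel n" unfolding n_def using truncate[OF f] by (auto intro: LeastI)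
  then obtain h where h: "range h \<subseteq> D" "power_sum s h n = \<zero>" "h n \<noteq> \<zero>" unfolding Rel_def by blast
  show thesis
  proof (rule that[OF h])
    fix g i assume g: "range g \<subseteq> D" "i < n" "power_sum s g i = \<zero>"
    show "\<forall>j\<le>i. g j = \<zero>"
    proof (rule ccontr)
      assume "\<not> ?thesis"
      then obtain j where "g j \<noteq> \<zero>" "j \<le> i" by blast
      from truncate[OF g(1,3) this] obtain l where "l \<le> i" "Rel l" by blast
      then have "n \<le> i" using Least_le[of Rel l] unfolding n_def by simp
      then show False using g by simp
    qed
  qed
qed

lemma (in cring) subring_plus_multiple:
  assumes D: "subring D R" and E: "subring E R" "D \<subseteq> E" and d: "d \<in> D"
  shows "subring {r \<oplus> d \<otimes> w | r w. r \<in> D \<and> w \<in> E} R" (is "subring ?T R")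
proof (rule subringI)
  note DE = subringE[OF D] and EE = subringE[OF E(1)]
  have DR: "x \<in> carrier R" if "x \<in> D" for x using DE(1) that by blast
  have ER: "x \<in> carrier R" if "x \<in> E" for x using EE(1) that by blast
  show "?T \<subseteq> carrier R" using DR ER d by auto
  have "\<one> = \<one> \<oplus> d \<otimes> \<zero>" using DR d by simp
  then show "\<one> \<in> ?T" using DE(3) EE(2) by blast
  fix x assume "x \<in> ?T"
  then obtain r w where x: "x = r \<oplus> d \<otimes> w" "r \<in> D" "w \<in> E" by blast
  have "\<ominus> x = \<ominus> r \<oplus> d \<otimes> \<ominus> w" using x DR ER d by (simp add: minus_add r_minus)
  then show "\<ominus> x \<in> ?T" using DE(5) EE(5) x by blast
  fix y assume "y \<in> ?T"
  then obtain q v where y: "y = q \<oplus> d \<otimes> v" "q \<in> D" "v \<in> E" by blast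
  have "x \<oplus> y = (r \<oplus> q) \<oplus> d \<otimes> (w \<oplus> v)" using x y DR ER d by (simp add: r_distr a_ac)
  then show "x \<oplus> y \<in> ?T" using DE(7) EE(7) x y by blast
  have "x \<otimes> y = (r \<otimes> q) \<oplus> d \<otimes> (r \<otimes> v \<oplus> q \<otimes> w \<oplus> d \<otimes> (w \<otimes> v))"
    using x y DR ER d by (simp add: r_distr l_distr a_ac m_ac)
  moreover have "r \<otimes> v \<oplus> q \<otimes> w \<oplus> d \<otimes> (w \<otimes> v) \<in> E" 
    by (intro EE(6,7) x y subsetD[OF E(2)] d)
  ultimately show "x \<otimes> y \<in> ?T" using DE(6) x y by blast
qed

text \<open>Every \<open>s\<close> is algebraic over \<open>D\<close>, by the relation lemma with \<open>M = {\<zero>}\<close>.  Let \<open>n\<close> be its least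
degree and \<open>a\<close> the product of \<open>s\<close> with the leading coefficient of a relation of degree \<open>n\<close>.  Then
\<open>a\<close> satisfies a monic relation of the same degree, so \<open>D[a]\<close> is free over \<open>D\<close> with basis
\<open>\<one>, a, \<dots>, a\<^bsup>n - 1\<^esup>\<close>.  If \<open>n \<ge> 2\<close>, the coordinates of \<open>\<one>\<close> and \<open>a\<close> can be compared, and for a nonzero
nonunit \<open>c\<close> of \<open>D\<close> the intermediate ring \<open>D \<oplus> c\<^sup>2 D[a]\<close> violates the criterion: \<open>a\<close> is a quotient
of its elements \<open>c\<^sup>2 a\<close> and \<open>c\<^sup>2\<close>, it does not lie in the ring, and \<open>c / a\<close> does not lie in it
either, although \<open>c\<close> is a nonunit of the ring.  So \<open>n = 1\<close>.\<close>

theorem (in domain) pseudo_valuative_pair_fractions: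
  assumes D: "subring D R"
    and pv: "\<And>T. subring T R \<Longrightarrow> D \<subseteq> T \<Longrightarrow> pseudo_valuative (R\<lparr>carrier := T\<rparr>)"
    and c: "c \<in> D" "c \<noteq> \<zero>" "c \<notin> Units (R\<lparr>carrier := D\<rparr>)"
    and s: "s \<in> carrier R"
  shows "\<exists>r\<in>D - {\<zero>}. r \<otimes> s \<in> D"
proof (cases "s = \<zero>")
  case True
  then show ?thesis using subringE(2,3)[OF D] by (intro bexI[of _ \<one>]) auto
next
  case s0: False
  note DE = subringE[OF D]
  have DR: "x \<in> carrier R" if "x \<in> D" for x using DE(1) that by blast
  have rDR: "range g \<subseteq> carrier R" if "range g \<subseteq> D" for g :: "nat \<Rightarrow> 'a"
    using that DE(1) by blast
  have ext: "subring (simple_extension D x) R" "D \<subseteq> simple_extension D x" "x \<in> simple_extension D x"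
    if "x \<in> carrier R" for x
    using simple_extension_is_subring[OF D that] simple_extension_incl[OF DE(1) that]
      simple_extension_mem[OF D that] by auto
  obtain n f where f: "range f \<subseteq> D" "power_sum s f n = \<zero>" "f n \<noteq> \<zero>"
    and indep: "\<And>g i. range g \<subseteq> D \<Longrightarrow> i < n \<Longrightarrow> power_sum s g i = \<zero> \<Longrightarrow> \<forall>j\<le>i. g j = \<zero>"
  proof -
    have "ideal {\<zero>} (R\<lparr>carrier := D\<rparr>)"
      using ring.zeroideal[OF subring_is_ring[OF D]] by simp
    then obtain d e where de: "d \<in> D" "d \<noteq> \<zero>" "e \<in> simple_extension D s" "d \<oplus> s \<otimes> e = \<zero>"
      using nontrivial_relation_of_local_simple_extension[OF D s pv[OF ext(1,2)[OF s]], of "{\<zero>}"]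
        s s0 integral_iff by auto
    obtain g m where g: "range g \<subseteq> D" "e = power_sum s g m"
      using simple_extension_power_sum[OF D s de(3)] .
    have "range (case_nat d g) \<subseteq> D" using de(1) g(1) by (auto simp: image_subset_iff split: nat.splits)
    moreover have "power_sum s (case_nat d g) (Suc m) = \<zero>"
      using power_sum_shift[OF s rDR[OF g(1)] DR[OF de(1)]] de(4) g(2) by simp
    ultimately show thesis
      using least_power_relation[OF D s, of "case_nat d g" "Suc m" 0 thesis] de(2) that by auto
  qed
  have fD: "f i \<in> D" for i using f(1) by auto
  have "n \<noteq> 0"
    using f power_sum_0[OF s, of f] DR[OF fD] by (cases n) auto
  then obtain n' where n': "n = Suc n'" by (cases n) auto
  show ?thesis
  proof (cases "n' = 0")
    case True
    have "power_sum s f 1 = f 0 \<oplus> f 1 \<otimes> s"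
      using power_sum_Suc[OF s rDR[OF f(1)], of 0] power_sum_0[OF s, of f] DR[OF fD] s by simp
    then have "f 1 \<otimes> s = \<ominus> f 0"
      using f(2) True n' s DR[OF fD] by (simp add: sum_zero_eq_neg a_comm)
    then have "f 1 \<otimes> s \<in> D" using DE(5)[OF fD[of 0]] by simp
    then show ?thesis using f(3) True n' fD[of 1] by auto
  next
    case False
    define a where "a = f n \<otimes> s"
    let ?E = "simple_extension D a" and ?L = "\<lambda>p. power_sum a p n'"
    have aR: "a \<in> carrier R" using s DR[OF fD] by (simp add: a_def)
    note E = ext[OF aR]
    have ER: "x \<in> carrier R" if "x \<in> ?E" for x using subringE(1)[OF E(1)] that by blast
    have apow: "a [^] i = f n [^] i \<otimes> s [^] i" for i :: nat
      using s DR[OF fD] by (simp add: a_def nat_pow_distrib)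
    have powD: "f n [^] (i::nat) \<in> D" for i
      by (induction i) (use DE(3,6) fD in auto)
    have powsum: "power_sum a p i = power_sum s (\<lambda>i. f n [^] i \<otimes> p i) i" if "range p \<subseteq> D" for p i
      unfolding power_sum_def
      using that s DR rDR[OF that] DR[OF powD]
      by (intro finsum_cong') (auto simp: apow m_ac image_subset_iff)
    have unique: "\<forall>j\<le>n'. p j = \<zero>" if p: "range p \<subseteq> D" "?L p = \<zero>" for p
    proof -
      have "range (\<lambda>i. f n [^] i \<otimes> p i) \<subseteq> D" using p powD DE(6) by blast
      then have "\<forall>j\<le>n'. f n [^] j \<otimes> p j = \<zero>"
        by (rule indep) (use n' powsum[OF p(1), of n'] p(2) in \<open>simp_all only: lessI\<close>)
      moreover have "f n [^] j \<noteq> \<zero>" for j :: nat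
        using f(3) DR[OF fD] by (induction j) (auto simp: integral_iff)
      ultimately show ?thesis using integral_iff DR[OF powD] rDR[OF p(1)] by blast
    qed
    \<comment> \<open>Multiplying the relation by the \<open>n'\<close>-th power of its leading coefficient makes it monic
      in \<open>a\<close>.\<close>
    define h where "h i = \<ominus> (f i \<otimes> f n [^] (n' - i))" for i
    have hD: "range h \<subseteq> D" using fD powD DE(5,6) by (auto simp: h_def)
    have monic: "a [^] Suc n' = ?L h"
    proof -
      have "?L h = power_sum s (\<lambda>i. \<ominus> (f n [^] n') \<otimes> f i) n'"
        unfolding powsum[OF hD]
      proof (rule power_sum_cong[OF s])
        fix i assume "i \<le> n'"
        then have "f n [^] n' = f n [^] i \<otimes> f n [^] (n' - i)" using nat_pow_mult[of "f n" i "n' - i"] DR[OF fD] by simp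
        then show "f n [^] i \<otimes> h i = \<ominus> (f n [^] n') \<otimes> f i"
          using DR[OF fD] by (simp add: h_def l_minus r_minus m_ac)
      qed (use DR[OF fD] in auto)
      also have "\<dots> = \<ominus> (f n [^] n') \<otimes> power_sum s f n'"
        using DR[OF fD] by (intro power_sum_smult[OF s _ rDR[OF f(1)]]) auto
      also have "power_sum s f n' = \<ominus> (f n \<otimes> s [^] Suc n')"
      proof (rule minus_equality[symmetric])
        show "power_sum s f n' \<oplus> f n \<otimes> s [^] Suc n' = \<zero>"
          using f(2) unfolding n' power_sum_Suc[OF s rDR[OF f(1)], of n'] .
      qed (use s DR[OF fD] power_sum_closed[OF s rDR[OF f(1)]] in auto)
      also have "\<ominus> (f n [^] n') \<otimes> \<ominus> (f n \<otimes> s [^] Suc n') = a [^] Suc n'"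
        unfolding apow using DR[OF fD] s by (simp add: l_minus r_minus m_ac)
      finally show ?thesis by simp
    qed
    have basis: "\<exists>p. range p \<subseteq> D \<and> x = ?L p" if "x \<in> ?E" for x
      using that
    proof (induction rule: simple_extension.induct)
      case zero
      have "?L (\<lambda>_. \<zero>) = \<zero>" unfolding power_sum_def using aR by (intro add.finprod_one_eqI) auto
      then show ?case using DE(2) by (intro exI[of _ "\<lambda>_. \<zero>"]) auto
    next
      case (lin x k)
      then obtain p where p: "range p \<subseteq> D" "x = ?L p" by blast
      have pD: "p i \<in> D" for i using p(1) by auto
      have shD: "range (case_nat k p) \<subseteq> D" using p(1) lin(2) by (auto simp: image_subset_iff split: nat.splits)
      let ?q = "\<lambda>i. case_nat k p i \<oplus> p n' \<otimes> h i"
      have "x \<otimes> a \<oplus> k = power_sum a (case_nat k p) (Suc n')"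
        using power_sum_shift[OF aR rDR[OF p(1)] DR[OF lin(2)], of n'] p(2) aR DR[OF lin(2)]
          power_sum_closed[OF aR rDR[OF p(1)]] by (simp add: m_comm a_comm)
      also have "\<dots> = ?L (case_nat k p) \<oplus> p n' \<otimes> ?L h"
        using power_sum_Suc[OF aR rDR[OF shD], of n'] monic by simp
      also have "\<dots> = ?L ?q"
        using power_sum_add[OF aR rDR[OF shD], of "\<lambda>i. p n' \<otimes> h i" n'] power_sum_smult[OF aR DR[OF pD] rDR[OF hD]]
          DR[OF pD] rDR[OF hD] by (auto simp: image_subset_iff)
      finally have "x \<otimes> a \<oplus> k = ?L ?q" .
      moreover have "range ?q \<subseteq> D" using shD hD pD DE(6,7) by (auto simp: image_subset_iff)
      ultimately show ?case by blast
    qed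
    have coords: "(\<exists>u\<in>D. r0 = d \<otimes> u) \<and> (\<exists>u\<in>D. r1 = d \<otimes> u)"
      if r: "r0 \<in> D" "r1 \<in> D" "d \<in> D" "w \<in> ?E" "r0 \<oplus> r1 \<otimes> a = d \<otimes> w" for r0 r1 d w
    proof -
      obtain p where p: "range p \<subseteq> D" "w = ?L p" using basis[OF r(4)] by blast
      have pD: "p i \<in> D" for i using p(1) by auto
      define e where "e i = (if i = 0 then r0 else if i = 1 then r1 else \<zero>)" for i :: nat
      have e_simps: "e 0 = r0" "e (Suc 0) = r1" "e (Suc (Suc i)) = \<zero>" for i by (simp_all add: e_def)
      have eD: "range e \<subseteq> D" using r DE(2) by (auto simp: e_def)
      have "power_sum a e (Suc i) = r0 \<oplus> r1 \<otimes> a" for i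
      proof (induction i)
        case 0
        show ?case using power_sum_Suc[OF aR rDR[OF eD], of 0] power_sum_0[OF aR, of e] DR[OF r(1)] aR
          by (simp add: e_simps)
      next
        case (Suc i)
        show ?case using power_sum_Suc[OF aR rDR[OF eD], of "Suc i"] Suc DR[OF r(1)] DR[OF r(2)] aR
          by (simp add: e_simps del: nat_pow_Suc)
      qed
      then have e: "?L e = d \<otimes> ?L p" using False r(5) p(2) by (cases n') auto
      let ?g = "\<lambda>i. e i \<oplus> \<ominus> d \<otimes> p i"
      have "?L ?g = ?L e \<oplus> \<ominus> d \<otimes> ?L p"
        using power_sum_add[OF aR rDR[OF eD], of "\<lambda>i. \<ominus> d \<otimes> p i" n'] power_sum_smult[OF aR _ rDR[OF p(1)], of "\<ominus> d" n']
          DR[OF r(3)] DR[OF pD] by (auto simp: image_subset_iff)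
      then have "?L ?g = \<zero>"
        using e DR[OF r(3)] power_sum_closed[OF aR rDR[OF p(1)], of n'] by (simp add: l_minus r_neg)
      moreover have "range ?g \<subseteq> D" using eD pD DE(5,6,7) r(3) by (auto simp: image_subset_iff)
      ultimately have z: "e j \<oplus> \<ominus> d \<otimes> p j = \<zero>" if "j \<le> n'" for j using unique[of ?g] that by blast
      have "e j = d \<otimes> p j" if "j \<le> n'" for j
        using z[OF that] DR[OF pD] DR[OF r(3)] rDR[OF eD] sum_zero_eq_neg[of "e j" "\<ominus> (d \<otimes> p j)"]
        by (auto simp: l_minus image_subset_iff)
      from this[of 0] this[of 1] False show ?thesis using pD by (auto simp: e_def)
    qed
    define d where "d = c \<otimes> c"
    have dD: "d \<in> D" "d \<noteq> \<zero>" using c DE(6) DR integral_iff by (auto simp: d_def)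
    define T where "T = {r \<oplus> d \<otimes> w | r w. r \<in> D \<and> w \<in> ?E}"
    have T: "subring T R" unfolding T_def by (rule subring_plus_multiple[OF D E(1,2) dD(1)])
    have "D \<subseteq> T"
    proof
      fix r assume "r \<in> D"
      then show "r \<in> T" unfolding T_def using subringE(2)[OF E(1)] DR dD
        by (intro CollectI exI[of _ r] exI[of _ \<zero>]) auto
    qed
    have nonunit: "\<one> \<noteq> c \<otimes> u" if "u \<in> D" for u
      using c that by (auto simp: Units_subring[OF D])
    have cR: "c \<in> carrier R" "d \<in> carrier R" using c dD DR by auto
    \<comment> \<open>The square matters only in \<open>T2\<close>: comparing constant coordinates there gives \<open>c = d u\<close>, which
      is absurd because \<open>d\<close> is a proper multiple of \<open>c\<close>.\<close>
    have T1: "a \<notin> T"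
    proof
      assume "a \<in> T"
      then obtain r w where rw: "a = r \<oplus> d \<otimes> w" "r \<in> D" "w \<in> ?E" unfolding T_def by blast
      then have "\<ominus> r \<oplus> \<one> \<otimes> a = d \<otimes> w" using DR ER cR aR
        by (simp add: a_assoc[symmetric] l_neg)
      then obtain u where "u \<in> D" "\<one> = d \<otimes> u" using coords[of "\<ominus> r" \<one> d w] rw DE(3,5) dD by blast
      then show False using nonunit[of "c \<otimes> u"] c DE(6) DR by (auto simp: d_def m_assoc)
    qed
    have T2: "c \<noteq> a \<otimes> z" if z: "z \<in> T" for z
    proof
      assume *: "c = a \<otimes> z"
      obtain r w where rw: "z = r \<oplus> d \<otimes> w" "r \<in> D" "w \<in> ?E" using z unfolding T_def by blast
      have "c = r \<otimes> a \<oplus> d \<otimes> (a \<otimes> w)" using * rw aR DR ER cR by (simp add: r_distr m_ac)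
      then have "c \<oplus> \<ominus> r \<otimes> a = d \<otimes> (a \<otimes> w)"
        using rw aR DR ER cR by (simp add: l_minus a_ac r_neg) (simp add: a_assoc[symmetric] r_neg)
      then obtain u where u: "u \<in> D" "c = d \<otimes> u"
        using coords[of c "\<ominus> r" d "a \<otimes> w"] rw DE(5) dD c E(3) subringE(6)[OF E(1)] by blast
      then have "c \<otimes> \<one> = c \<otimes> (c \<otimes> u)" using cR DR by (simp add: d_def m_assoc)
      then show False using nonunit[OF u(1)] m_lcancel[of c \<one> "c \<otimes> u"] cR DR u c(2) by auto
    qed
    have T3: "c \<otimes> z \<noteq> \<one>" if "z \<in> T" for z
    proof
      assume *: "c \<otimes> z = \<one>"
      have z: "z \<in> ?E" using that E(2) dD subringE(6,7)[OF E(1)] unfolding T_def by blast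
      have "\<one> \<oplus> \<zero> \<otimes> a = (c \<otimes> z) \<otimes> (c \<otimes> z)" unfolding * using aR by simp
      also have "\<dots> = d \<otimes> (z \<otimes> z)" using cR ER[OF z] by (simp add: d_def m_ac)
      finally obtain u where "u \<in> D" "\<one> = d \<otimes> u"
        using coords[of \<one> \<zero> d "z \<otimes> z"] DE(2,3) dD z subringE(6)[OF E(1)] by blast
      then show False using nonunit[of "c \<otimes> u"] c DE(6) DR by (auto simp: d_def m_assoc)
    qed
    have "d \<otimes> a \<in> T" unfolding T_def using DE(2) E(3) cR aR
      by (intro CollectI exI[of _ \<zero>] exI[of _ a]) auto
    have "d \<in> T" "c \<in> T" using \<open>D \<subseteq> T\<close> c(1) dD(1) by auto
    note facts = T pv[OF T \<open>D \<subseteq> T\<close>] \<open>d \<otimes> a \<in> T\<close> this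
    from facts have False
    proof (cases rule: pseudo_valuative_subring_cases)
      case (divides z)
      then have "a = z" using m_lcancel[OF dD(2) cR(2) aR, of z] subringE(1)[OF T] by blast
      then show False using T1 divides(1) by blast
    next
      case (divides_mult z)
      have zR: "z \<in> carrier R" using divides_mult(1) subringE(1)[OF T] by blast
      have "d \<otimes> c = d \<otimes> (a \<otimes> z)" using divides_mult(2) m_assoc[OF cR(2) aR zR] by simp
      then have "c = a \<otimes> z" using m_lcancel[OF dD(2) cR(2,1), of "a \<otimes> z"] aR zR by blast
      then show False using T2 divides_mult(1) by blast
    next
      case (unit z) then show False using T3 by blast
    qed
    then show ?thesis ..
  qed
qed

section \<open>Norms of polynomials over a finite group of automorphisms\<close>

lemma (in cring) UP_map_ring_hom:
  assumes h: "h \<in> ring_hom R R"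
  shows "(\<lambda>p i. h (p i)) \<in> ring_hom (UP R) (UP R)"
proof -
  interpret h: ring_hom_cring R R h by (rule ring_hom_cringI) (use h is_cring in auto)
  have closed: "(\<lambda>i. h (p i)) \<in> up R" if p: "p \<in> up R" for p
  proof -
    obtain n where "bound \<zero> n p" using bound_upD[OF p] by blast
    then have "bound \<zero> n (\<lambda>i. h (p i))" by (auto simp: bound_def)
    then show ?thesis using p by (intro mem_upI) (auto simp: mem_upD)
  qed
  show ?thesis
  proof (rule ring_hom_memI)
    fix p q assume p: "p \<in> carrier (UP R)" "q \<in> carrier (UP R)"
    show "(\<lambda>i. h ((p \<otimes>\<^bsub>UP R\<^esub> q) i)) = (\<lambda>i. h (p i)) \<otimes>\<^bsub>UP R\<^esub> (\<lambda>i. h (q i))"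
      using p closed by (auto simp: UP_def mem_upD fun_eq_iff Pi_def intro!: finsum_cong')
    show "(\<lambda>i. h ((p \<oplus>\<^bsub>UP R\<^esub> q) i)) = (\<lambda>i. h (p i)) \<oplus>\<^bsub>UP R\<^esub> (\<lambda>i. h (q i))"
      using p closed by (auto simp: UP_def mem_upD fun_eq_iff)
  qed (auto simp: UP_def closed fun_eq_iff)
qed

lemma UP_coeff: "p \<in> carrier (UP R) \<Longrightarrow> up_ring.coeff (UP R) p i = p i"
  by (simp add: UP_def)

lemma (in UP_cring) coeff_0_mult:
  "p \<in> carrier P \<Longrightarrow> q \<in> carrier P \<Longrightarrow>
    up_ring.coeff P (p \<otimes>\<^bsub>P\<^esub> q) 0 = up_ring.coeff P p 0 \<otimes> up_ring.coeff P q 0"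
  by simp

lemma (in UP_cring) coeff_0_one_plus_X_mult:
  assumes "q \<in> carrier P"
  shows "up_ring.coeff P (\<one>\<^bsub>P\<^esub> \<oplus>\<^bsub>P\<^esub> up_ring.monom P \<one> 1 \<otimes>\<^bsub>P\<^esub> q) 0 = \<one>"
  using assms by simp

lemma (in UP_cring) coeff_0_finprod:
  assumes "finite H" "\<And>h. h \<in> H \<Longrightarrow> f h \<in> carrier P" "\<And>h. h \<in> H \<Longrightarrow> up_ring.coeff P (f h) 0 = \<one>"
  shows "up_ring.coeff P (\<Otimes>\<^bsub>P\<^esub>h\<in>H. f h) 0 = \<one>"
  using assms
proof (induction H rule: finite_induct)
  case (insert h H)
  then have "(\<Otimes>\<^bsub>P\<^esub>h\<in>insert h H. f h) = f h \<otimes>\<^bsub>P\<^esub> (\<Otimes>\<^bsub>P\<^esub>h\<in>H. f h)"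
    by (intro P.finprod_insert) auto
  moreover have "(\<Otimes>\<^bsub>P\<^esub>h\<in>H. f h) \<in> carrier P"
    using insert.prems by (intro P.finprod_closed) auto
  ultimately show ?case using insert coeff_0_mult[of "f h" "\<Otimes>\<^bsub>P\<^esub>h\<in>H. f h"] by simp
qed simp

lemma ring_autoD:
  assumes "subgroup G (RingAutoGroup R)" "\<sigma> \<in> G"
  shows "\<sigma> \<in> ring_hom R R" "\<sigma> \<in> extensional (carrier R)" "inj_on \<sigma> (carrier R)"
  using assms subgroup.subset[OF assms(1)]
  by (auto simp: RingAutoGroup_def ring_auto_def Bij_def bij_betw_def)

lemma RingAutoGroup_compose_closed:
  assumes "subgroup G (RingAutoGroup R)" "\<sigma> \<in> G" "\<tau> \<in> G"
  shows "compose (carrier R) \<sigma> \<tau> \<in> G"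
proof -
  have "\<sigma> \<in> Bij (carrier R)" "\<tau> \<in> Bij (carrier R)"
    using assms(2,3) subgroup.subset[OF assms(1)] by (auto simp: RingAutoGroup_def ring_auto_def)
  then show ?thesis
    using subgroup.m_closed[OF assms] by (simp add: RingAutoGroup_def BijGroup_def)
qed

text \<open>Injectivity needs extensionality: automorphisms that agree on the carrier are equal.  Surjectivity
then comes from finiteness.\<close>

lemma RingAutoGroup_left_compose_bij:
  assumes G: "subgroup G (RingAutoGroup R)" "finite G" and \<tau>: "\<tau> \<in> G"
  shows "inj_on (compose (carrier R) \<tau>) G" "compose (carrier R) \<tau> ` G = G"
proof -
  show inj: "inj_on (compose (carrier R) \<tau>) G"
  proof (rule inj_onI, rule ext)
    fix \<sigma> \<rho> x assume *: "\<sigma> \<in> G" "\<rho> \<in> G" "compose (carrier R) \<tau> \<sigma> = compose (carrier R) \<tau> \<rho>"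
    show "\<sigma> x = \<rho> x"
    proof (cases "x \<in> carrier R")
      case True
      then have "\<tau> (\<sigma> x) = \<tau> (\<rho> x)" using fun_cong[OF *(3), of x] by (simp add: compose_def)
      then show ?thesis
        by (rule inj_onD[OF ring_autoD(3)[OF G(1) \<tau>] _
              ring_hom_closed[OF ring_autoD(1)[OF G(1) *(1)] True]
              ring_hom_closed[OF ring_autoD(1)[OF G(1) *(2)] True]])
    next
      case False
      then show ?thesis
        using extensional_arb[OF ring_autoD(2)[OF G(1) *(1)] False]
          extensional_arb[OF ring_autoD(2)[OF G(1) *(2)] False] by metis
    qed
  qed
  have "compose (carrier R) \<tau> ` G \<subseteq> G" using RingAutoGroup_compose_closed[OF G(1) \<tau>] by blast
  then show "compose (carrier R) \<tau> ` G = G" using endo_inj_surj[OF G(2) _ inj] by blast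
qed

text \<open>An inverse \<open>q(t)\<close> of \<open>t\<close> in \<open>D[t]\<close> makes \<open>t\<close> a root of \<open>f = \<one> - X q\<close>.  The product \<open>F\<close>
of the conjugates of \<open>f\<close> has invariant coefficients and still has constant coefficient \<open>\<one>\<close>, and
it still vanishes at \<open>t\<close> since \<open>f\<close> is one of the factors.  So \<open>F(t) = \<zero>\<close> exhibits an inverse
of \<open>t\<close> as a polynomial in \<open>t\<close> with coefficients in \<open>D\<^sup>G\<close>.\<close>

lemma (in domain) simple_extension_inverse_descends:
  assumes D: "subring D R" and G: "subgroup G (RingAutoGroup R)" "finite G"
    and stable: "\<forall>\<sigma>\<in>G. \<sigma> ` D \<subseteq> D"
    and t: "t \<in> carrier R" "\<exists>p\<in>simple_extension D t. t \<otimes> p = \<one>"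
    and T: "subring T R" "fixed_set G D \<subseteq> T" "t \<in> T"
  shows "\<exists>u\<in>T. t \<otimes> u = \<one>"
proof -
  let ?D = "R\<lparr>carrier := D\<rparr>" and ?P = "UP (R\<lparr>carrier := D\<rparr>)"
  note DE = subringE[OF D] and TE = subringE[OF T(1)]
  have DR: "x \<in> carrier R" if "x \<in> D" for x using DE(1) that by blast
  have TR: "x \<in> carrier R" if "x \<in> T" for x using TE(1) that by blast
  interpret D: domain ?D by (rule subring_is_domain[OF D])
  interpret incl: ring_hom_cring ?D R id
    by (rule ring_hom_cringI) (auto intro!: ring_hom_memI simp: D.is_cring is_cring DR)
  interpret P: UP_cring ?D ?P by (simp add: UP_cring_def D.is_cring) 
  interpret P': UP_pre_univ_prop ?D R id ?P
    by (simp add: UP_pre_univ_prop_def incl.ring_hom_cring_axioms P.UP_cring_axioms)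
  define ev where "ev = UnivPoly.eval ?D R id t"
  interpret ev: ring_hom_cring ?P R ev
    unfolding ev_def by (rule ring_hom_cringI) (rule P.P.is_cring is_cring P'.eval_ring_hom t)+
  have coeff: "p i = up_ring.coeff ?P p i" if "p \<in> carrier ?P" for p i
    by (rule UP_coeff[OF that, symmetric])
  let ?X = "up_ring.monom ?P \<one> 1"
  have X: "?X \<in> carrier ?P" "ev ?X = t"
    using P.monom_closed[of \<one> 1] P'.eval_monom1[OF t(1)] DE(3) by (auto simp: ev_def)
  have surj: "\<exists>q\<in>carrier ?P. ev q = p" if "p \<in> simple_extension D t" for p
    using that
  proof (induction rule: simple_extension.induct)
    case zero
    show ?case by (intro bexI[of _ "\<zero>\<^bsub>?P\<^esub>"]) auto
  next
    case (lin p k)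
    then obtain q where q: "q \<in> carrier ?P" "ev q = p" by blast
    have k: "up_ring.monom ?P k 0 \<in> carrier ?P" "ev (up_ring.monom ?P k 0) = k"
      using P.monom_closed[of k 0] P'.eval_const[OF t(1), of k] lin(2) by (auto simp: ev_def)
    show ?case using q k X by (intro bexI[of _ "q \<otimes>\<^bsub>?P\<^esub> ?X \<oplus>\<^bsub>?P\<^esub> up_ring.monom ?P k 0"]) auto
  qed
  from t(2) surj obtain q where q: "q \<in> carrier ?P" "t \<otimes> ev q = \<one>" by blast
  define f where "f = \<one>\<^bsub>?P\<^esub> \<oplus>\<^bsub>?P\<^esub> ?X \<otimes>\<^bsub>?P\<^esub> (\<ominus>\<^bsub>?P\<^esub> q)"
  have f: "f \<in> carrier ?P" using X q by (simp add: f_def)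
  have evf: "ev f = \<zero>" using X q t by (simp add: f_def r_minus r_neg)
  have f0: "f 0 = \<one>"
    using P.coeff_0_one_plus_X_mult[OF P.P.a_inv_closed[OF q(1)]] coeff[OF f, of 0]
    unfolding f_def by (simp only:) simp
  define act where "act \<sigma> p = (\<lambda>i. \<sigma> (p i))" for \<sigma> :: "'a \<Rightarrow> 'a" and p :: "nat \<Rightarrow> 'a"
  have homD: "\<sigma> \<in> ring_hom ?D ?D" if "\<sigma> \<in> G" for \<sigma>
    using ring_autoD(1)[OF G(1) that] stable that DR
    by (intro ring_hom_memI) (auto simp: ring_hom_mult ring_hom_add ring_hom_one)
  have act: "act \<sigma> \<in> ring_hom ?P ?P" if "\<sigma> \<in> G" for \<sigma>
    unfolding act_def by (rule D.UP_map_ring_hom[OF homD[OF that]])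
  have actf: "act \<sigma> f \<in> carrier ?P" if "\<sigma> \<in> G" for \<sigma>
    using ring_hom_closed[OF act[OF that] f] .
  define F where "F = (\<Otimes>\<^bsub>?P\<^esub>\<sigma>\<in>G. act \<sigma> f)"
  have F: "F \<in> carrier ?P" unfolding F_def using actf by (intro P.P.finprod_closed) auto
  have fixedF: "act \<tau> F = F" if \<tau>: "\<tau> \<in> G" for \<tau>
  proof -
    interpret \<tau>: ring_hom_cring ?P ?P "act \<tau>"
      by (rule ring_hom_cringI) (rule P.P.is_cring act[OF \<tau>])+
    have "act \<tau> F = (\<Otimes>\<^bsub>?P\<^esub>\<sigma>\<in>G. act \<tau> (act \<sigma> f))"
      unfolding F_def using actf by (subst \<tau>.hom_finprod) (auto simp: comp_def)
    also have "\<dots> = (\<Otimes>\<^bsub>?P\<^esub>\<sigma>\<in>G. act (compose (carrier R) \<tau> \<sigma>) f)"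
    proof (rule P.P.finprod_cong')
      fix \<sigma> assume "\<sigma> \<in> G"
      have "f i \<in> carrier R" for i using P.coeff_closed[OF f, of i] coeff[OF f, of i] DR by simp
      then show "act \<tau> (act \<sigma> f) = act (compose (carrier R) \<tau> \<sigma>) f"
        by (simp add: act_def compose_def)
    qed (use actf RingAutoGroup_compose_closed[OF G(1) \<tau>] in auto)
    also have "\<dots> = (\<Otimes>\<^bsub>?P\<^esub>\<sigma>\<in>compose (carrier R) \<tau> ` G. act \<sigma> f)"
      using RingAutoGroup_left_compose_bij[OF G \<tau>] actf
      by (intro P.P.finprod_reindex[symmetric]) auto
    also have "\<dots> = F" unfolding F_def RingAutoGroup_left_compose_bij(2)[OF G \<tau>] ..
    finally show ?thesis .
  qed
  have F_fixed: "F i \<in> fixed_set G D" for i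
    using fun_cong[OF fixedF, of _ i] P.coeff_closed[OF F, of i] coeff[OF F, of i]
    by (auto simp: fixed_set_def act_def)
  have F0: "F 0 = \<one>"
  proof -
    have "act \<sigma> f 0 = \<one>" if "\<sigma> \<in> G" for \<sigma>
      unfolding act_def f0 by (rule ring_hom_one[OF ring_autoD(1)[OF G(1) that]])
    then have "up_ring.coeff ?P (act \<sigma> f) 0 = \<one>\<^bsub>?D\<^esub>" if "\<sigma> \<in> G" for \<sigma>
      unfolding coeff[OF actf[OF that], symmetric] using that by simp
    from P.coeff_0_finprod[OF G(2) actf this] coeff[OF F, of 0]
    show ?thesis unfolding F_def by simp
  qed
  have evF: "ev F = \<zero>"
  proof -
    let ?i = "\<lambda>x\<in>carrier R. x"
    have i: "?i \<in> G" using subgroup.one_closed[OF G(1)] by (simp add: RingAutoGroup_def BijGroup_def)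
    have "f j \<in> carrier R" for j using P.coeff_closed[OF f, of j] coeff[OF f, of j] DR by simp
    then have "act ?i f = f" by (simp add: act_def)
    moreover have "F = act ?i f \<otimes>\<^bsub>?P\<^esub> (\<Otimes>\<^bsub>?P\<^esub>\<sigma>\<in>G - {?i}. act \<sigma> f)"
      unfolding F_def using P.P.finprod_insert[of "G - {?i}" ?i "\<lambda>\<sigma>. act \<sigma> f"] G(2) actf i
      by (simp add: insert_absorb Pi_def)
    moreover have "(\<Otimes>\<^bsub>?P\<^esub>\<sigma>\<in>G - {?i}. act \<sigma> f) \<in> carrier ?P"
      using actf by (intro P.P.finprod_closed) auto
    ultimately show ?thesis using f evf by simp
  qed
  have FT: "F i \<in> T" for i using F_fixed T(2) by blast
  have rF: "range F \<subseteq> carrier R" using FT TE(1) by blast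
  have "ev F = power_sum t F (deg ?D F)"
    unfolding ev_def power_sum_def P.eval_on_carrier[OF F] using coeff[OF F] by simp
  moreover have "\<exists>w\<in>T. power_sum t F n = \<one> \<oplus> t \<otimes> w" for n
  proof (induction n)
    case 0
    show ?case using TE(2) F0 power_sum_0[OF t(1), of F] t by (intro bexI[of _ \<zero>]) auto
  next
    case (Suc n)
    then obtain w where w: "w \<in> T" "power_sum t F n = \<one> \<oplus> t \<otimes> w" by blast
    have tn: "t [^] n \<in> T" by (induction n) (use TE(3,6) T(3) in auto)
    have "power_sum t F (Suc n) = \<one> \<oplus> t \<otimes> (w \<oplus> F (Suc n) \<otimes> t [^] n)"
      using power_sum_Suc[OF t(1) rF, of n] w TR[OF w(1)] TR[OF FT] t(1)
      by (simp add: r_distr a_assoc) (simp add: m_ac)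
    then show ?case using w(1) tn FT TE(6,7) by blast
  qed
  ultimately obtain w where w: "w \<in> T" "\<one> \<oplus> t \<otimes> w = \<zero>" using evF by metis
  then have "t \<otimes> \<ominus> w = \<one>"
    using t(1) TR[OF w(1)] by (simp add: r_minus) (metis add.inv_closed minus_equality minus_minus m_closed one_closed)
  then show ?thesis using TE(5) w(1) by blast
qed

section \<open>Invariants of a pair\<close>

lemma (in ring) subring_subring_iff:
  assumes "subring B R"
  shows "subring A (R\<lparr>carrier := B\<rparr>) \<longleftrightarrow> subring A R \<and> A \<subseteq> B"
proof -
  have "A \<subseteq> B" if "subring A (R\<lparr>carrier := B\<rparr>)" using subringE(1)[OF that] by simp
  moreover have "subring A (R\<lparr>carrier := B\<rparr>) \<longleftrightarrow> subring A R" if "A \<subseteq> B"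
    using ring.subring_iff[OF subring_is_ring[OF assms], of A] subring_iff[of A] that subringE(1)[OF assms]
    by auto
  ultimately show ?thesis by blast
qed

lemma (in cring) fixed_set_subring:
  assumes G: "subgroup G (RingAutoGroup R)" and D: "subring D R"
  shows "subring (fixed_set G D) R"
proof (rule subringI)
  note DE = subringE[OF D]
  have hom: "ring_hom_cring R R \<sigma>" if "\<sigma> \<in> G" for \<sigma>
    by (rule ring_hom_cringI) (rule is_cring ring_autoD(1)[OF G that])+
  have fixed: "x \<in> D" "x \<in> carrier R" "\<sigma> \<in> G \<Longrightarrow> \<sigma> x = x" if "x \<in> fixed_set G D" for x \<sigma>
    using that DE(1) unfolding fixed_set_def by auto
  have memI: "x \<in> fixed_set G D" if "x \<in> D" "\<And>\<sigma>. \<sigma> \<in> G \<Longrightarrow> \<sigma> x = x" for x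
    using that unfolding fixed_set_def by blast
  show "fixed_set G D \<subseteq> carrier R" using fixed by blast
  show "\<one> \<in> fixed_set G D"
  proof (rule memI[OF DE(3)])
    show "\<sigma> \<one> = \<one>" if "\<sigma> \<in> G" for \<sigma>
      by (rule ring_hom_one[OF ring_autoD(1)[OF G that]])
  qed
  fix x assume x: "x \<in> fixed_set G D"
  show "\<ominus> x \<in> fixed_set G D"
  proof (rule memI[OF DE(5)[OF fixed(1)[OF x]]])
    show "\<sigma> (\<ominus> x) = \<ominus> x" if "\<sigma> \<in> G" for \<sigma>
      using ring_hom_cring.hom_a_inv[OF hom[OF that] fixed(2)[OF x]] fixed(3)[OF x that] by simp
  qed
  fix y assume y: "y \<in> fixed_set G D"
  show "x \<otimes> y \<in> fixed_set G D"
  proof (rule memI[OF DE(6)[OF fixed(1)[OF x] fixed(1)[OF y]]])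
    show "\<sigma> (x \<otimes> y) = x \<otimes> y" if "\<sigma> \<in> G" for \<sigma>
      using ring_hom_mult[OF ring_autoD(1)[OF G that] fixed(2)[OF x] fixed(2)[OF y]]
        fixed(3)[OF x that] fixed(3)[OF y that] by simp
  qed
  show "x \<oplus> y \<in> fixed_set G D"
  proof (rule memI[OF DE(7)[OF fixed(1)[OF x] fixed(1)[OF y]]])
    show "\<sigma> (x \<oplus> y) = x \<oplus> y" if "\<sigma> \<in> G" for \<sigma>
      using ring_hom_add[OF ring_autoD(1)[OF G that] fixed(2)[OF x] fixed(2)[OF y]]
        fixed(3)[OF x that] fixed(3)[OF y that] by simp
  qed
qed

text \<open>Apply \<open>\<sigma>\<close> to \<open>a = b \<otimes> u\<close> and cancel \<open>b\<close>.  This is how divisibility over \<open>D\<close> descends to \<open>D\<^sup>G\<close>.\<close>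

lemma (in domain) fixed_quotient:
  assumes G: "subgroup G (RingAutoGroup R)" and D: "D \<subseteq> carrier R"
    and ab: "a \<in> fixed_set G (carrier R)" "b \<in> fixed_set G (carrier R)" "b \<noteq> \<zero>"
    and u: "u \<in> D" "a = b \<otimes> u" and stable: "\<forall>\<sigma>\<in>G. \<sigma> ` D \<subseteq> D"
  shows "u \<in> fixed_set G D"
proof -
  have "\<sigma> u = u" if "\<sigma> \<in> G" for \<sigma>
  proof -
    have R: "u \<in> carrier R" "b \<in> carrier R" "\<sigma> u \<in> carrier R"
      using u D ab that stable by (auto simp: fixed_set_def)
    have fixed: "\<sigma> a = a" "\<sigma> b = b" using ab(1,2) that unfolding fixed_set_def by blast+
    have "b \<otimes> \<sigma> u = \<sigma> (b \<otimes> u)"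
      using ring_hom_mult[OF ring_autoD(1)[OF G that] R(2,1)] fixed(2) by simp
    also have "\<dots> = b \<otimes> u" using fixed(1) u(2) by simp
    finally show ?thesis using m_lcancel[OF ab(3) R(2,3,1)] by blast
  qed
  then show ?thesis using u(1) by (simp add: fixed_set_def)
qed

text \<open>In terms of the valuation ring of \<open>D\<close>: an element \<open>m\<close> outside \<open>D\<close> has value at most \<open>0\<close>, so
\<open>m \<otimes> x\<close> can have positive value only if \<open>x\<close> has.  If \<open>D\<close> is a field, the premise on \<open>m \<otimes> x\<close> just
says \<open>m \<otimes> x = \<zero>\<close>; otherwise \<open>m\<close> is a fraction over \<open>D\<close> and the criterion for \<open>D\<close> applies to it.\<close>

lemma (in domain) pseudo_valuative_pair_cancel:
  assumes D: "subring D R"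
    and pv: "\<And>T. subring T R \<Longrightarrow> D \<subseteq> T \<Longrightarrow> pseudo_valuative (R\<lparr>carrier := T\<rparr>)"
    and m: "m \<in> carrier R" "m \<notin> D"
    and x: "x \<in> carrier R" "m \<otimes> x \<in> D - Units (R\<lparr>carrier := D\<rparr>)"
  shows "x \<in> D - Units (R\<lparr>carrier := D\<rparr>)"
proof -
  note DE = subringE[OF D]
  have DR: "x \<in> carrier R" if "x \<in> D" for x using DE(1) that by blast
  have m0: "m \<noteq> \<zero>" using m DE(2) by blast
  have mx: "m \<otimes> x \<in> D" "m \<otimes> x \<notin> Units (R\<lparr>carrier := D\<rparr>)" using x(2) by auto
  have nonunit: "m \<otimes> x \<otimes> c \<noteq> \<one>" if "c \<in> D" for c
    using mx that by (auto simp: Units_subring[OF D])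
  show ?thesis
  proof (cases "m \<otimes> x = \<zero>")
    case True
    then have "x = \<zero>" using integral_iff[OF m(1) x(1)] m0 by simp
    then show ?thesis using x(2) True by simp
  next
    case False
    obtain r where r: "r \<in> D" "r \<noteq> \<zero>" "r \<otimes> m \<in> D"
      using pseudo_valuative_pair_fractions[OF D pv mx(1) False mx(2) m(1)] by blast
    note facts = D pv[OF D subset_refl] r(3,1) mx(1)
    from facts have xD: "x \<in> D"
    proof (cases rule: pseudo_valuative_subring_cases)
      case (divides c)
      then have "m = c" using m_lcancel[OF r(2) DR[OF r(1)] m(1) DR] by blast
      then show ?thesis using divides(1) m(2) by blast
    next
      case (divides_mult c)
      note R = DR[OF r(1)] m(1) x(1) DR[OF divides_mult(1)]
      have "(r \<otimes> m) \<otimes> x = (r \<otimes> m) \<otimes> c" using divides_mult(2) m_assoc[OF R(1,2,3)] by simp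
      moreover have "r \<otimes> m \<noteq> \<zero>" using integral_iff[OF R(1,2)] r(2) m0 by blast
      ultimately have "x = c" using m_lcancel[OF _ m_closed[OF R(1,2)] R(3,4)] by blast
      then show ?thesis using divides_mult(1) by simp
    next
      case (unit c)
      then show ?thesis using nonunit by blast
    qed
    moreover have "x \<notin> Units (R\<lparr>carrier := D\<rparr>)"
    proof
      assume "x \<in> Units (R\<lparr>carrier := D\<rparr>)"
      then obtain c where c: "c \<in> D" "x \<otimes> c = \<one>" by (auto simp: Units_subring[OF D])
      have "m = m \<otimes> x \<otimes> c" using c m(1) x(1) DR by (simp add: m_assoc)
      then show False using DE(6)[OF mx(1) c(1)] m(2) by simp
    qed
    ultimately show ?thesis by blast
  qed
qed

text \<open>A nonunit \<open>m\<close> of \<open>T\<close> must be a nonunit of \<open>D\<close>.  Indeed, if it lay outside \<open>D\<close>, it would have an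
inverse in the local ring \<open>D[m]\<close>, hence in \<open>T\<close> by the norm argument; and inverses in \<open>D\<close> of invariant
elements are invariant.  If such an \<open>m\<close> is nonzero, then \<open>D\<close> is not a field, so elements \<open>a\<close> and
\<open>b\<close> of \<open>T\<close> are fractions over \<open>D\<close>, and the criterion for \<open>D\<close> applied to \<open>a / b\<close> and \<open>m\<close> descends to
\<open>T\<close>.\<close>

theorem (in domain) pseudo_valuative_between_invariants:
  assumes D: "subring D R"
    and pv: "\<And>T. subring T R \<Longrightarrow> D \<subseteq> T \<Longrightarrow> pseudo_valuative (R\<lparr>carrier := T\<rparr>)"
    and G: "subgroup G (RingAutoGroup R)" "finite G" and stable: "\<forall>\<sigma>\<in>G. \<sigma> ` D \<subseteq> D"
    and T: "subring T R" "fixed_set G D \<subseteq> T" "T \<subseteq> fixed_set G (carrier R)"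
  shows "pseudo_valuative (R\<lparr>carrier := T\<rparr>)"
proof -
  note DE = subringE[OF D] and TE = subringE[OF T(1)]
  have DR: "x \<in> carrier R" if "x \<in> D" for x using DE(1) that by blast
  have TR: "x \<in> carrier R" if "x \<in> T" for x using TE(1) that by blast
  have quotient: "u \<in> T" if "a \<in> T" "b \<in> T" "b \<noteq> \<zero>" "u \<in> D" "a = b \<otimes> u" for a b u
    using fixed_quotient[OF G(1) DE(1) _ _ that(3-5) stable] that(1,2) T by blast
  have nonunit: "m \<in> D - Units (R\<lparr>carrier := D\<rparr>)" if m: "m \<in> T" "\<not> (\<exists>c\<in>T. m \<otimes> c = \<one>)" for m
  proof (cases "m \<in> D")
    case True
    have "m \<otimes> c \<noteq> \<one>" if c: "c \<in> D" for c
    proof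
      assume *: "m \<otimes> c = \<one>"
      then have "m \<noteq> \<zero>" using DR[OF c] by auto
      then have "c \<in> T" using quotient[OF TE(3) m(1) _ c] * by simp
      then show False using m(2) * by blast
    qed
    then show ?thesis using True by (auto simp: Units_subring[OF D])
  next
    case False
    have mR: "m \<in> carrier R" using TR[OF m(1)] .
    have "subring (simple_extension D m) R" "D \<subseteq> simple_extension D m"
      using simple_extension_is_subring[OF D mR] simple_extension_incl[OF DE(1) mR] by auto
    then have "pseudo_valuative (R\<lparr>carrier := simple_extension D m\<rparr>)" by (rule pv)
    from inverse_in_local_simple_extension[OF D pv[OF D subset_refl] mR this
        pseudo_valuative_pair_cancel[OF D pv mR False]]
    have "\<exists>c\<in>simple_extension D m. m \<otimes> c = \<one>" by blast
    then have "\<exists>c\<in>T. m \<otimes> c = \<one>"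
      using simple_extension_inverse_descends[OF D G stable mR _ T(1,2) m(1)] by blast
    then show ?thesis using m(2) by blast
  qed
  show ?thesis
    unfolding pseudo_valuative_subring[OF T(1)]
  proof (intro ballI)
    fix a b m assume abm: "a \<in> T" "b \<in> T" "m \<in> T"
    have R: "a \<in> carrier R" "b \<in> carrier R" "m \<in> carrier R" using abm TR by auto
    show "(\<exists>c\<in>T. a = b \<otimes> c) \<or> (\<exists>c\<in>T. b \<otimes> m = a \<otimes> c) \<or> (\<exists>c\<in>T. m \<otimes> c = \<one>)"
    proof (cases "a = \<zero> \<or> b = \<zero> \<or> m = \<zero> \<or> (\<exists>c\<in>T. m \<otimes> c = \<one>)")
      case True
      then show ?thesis using R TE(2) by (metis l_null r_null)
    next
      case False
      then have m: "m \<in> D" "m \<notin> Units (R\<lparr>carrier := D\<rparr>)" "m \<noteq> \<zero>" and nz: "a \<noteq> \<zero>" "b \<noteq> \<zero>"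
        using nonunit[OF abm(3)] by auto
      obtain r where r: "r \<in> D" "r \<noteq> \<zero>" "r \<otimes> a \<in> D"
        using pseudo_valuative_pair_fractions[OF D pv m(1,3,2) R(1)] by blast
      obtain q where q: "q \<in> D" "q \<noteq> \<zero>" "q \<otimes> b \<in> D"
        using pseudo_valuative_pair_fractions[OF D pv m(1,3,2) R(2)] by blast
      define e where "e = r \<otimes> q"
      have e: "e \<in> carrier R" "e \<noteq> \<zero>" using r q DR integral_iff by (auto simp: e_def)
      have "e \<otimes> a = q \<otimes> (r \<otimes> a)" "e \<otimes> b = r \<otimes> (q \<otimes> b)"
        using DR[OF r(1)] DR[OF q(1)] R by (simp_all add: e_def m_ac)
      then have D': "e \<otimes> a \<in> D" "e \<otimes> b \<in> D" using DE(6) r q by auto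
      note facts = D pv[OF D subset_refl] D' m(1)
      from facts show ?thesis
      proof (cases rule: pseudo_valuative_subring_cases)
        case (divides u)
        then have "e \<otimes> a = e \<otimes> (b \<otimes> u)" using m_assoc[OF e(1) R(2) DR] by simp
        then have "a = b \<otimes> u" using m_lcancel[OF e(2,1) R(1), of "b \<otimes> u"] R(2) DR[OF divides(1)] by blast
        then show ?thesis using quotient[OF abm(1,2) nz(2) divides(1)] by blast
      next
        case (divides_mult u)
        then have "e \<otimes> (b \<otimes> m) = e \<otimes> (a \<otimes> u)"
          using m_assoc[OF e(1) R(1) DR] m_assoc[OF e(1) R(2,3)] by simp
        then have "b \<otimes> m = a \<otimes> u"
          using m_lcancel[OF e(2,1) m_closed[OF R(2,3)], of "a \<otimes> u"] R(1) DR[OF divides_mult(1)] by blast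
        then show ?thesis using quotient[OF TE(6)[OF abm(2,3)] abm(1) nz(1) divides_mult(1)] by blast
      next
        case (unit u)
        then show ?thesis using m(1,2) by (auto simp: Units_subring[OF D])
      qed
    qed
  qed
qed

theorem theorem3p4:
  fixes S :: "('a, 'm) ring_scheme" and R :: "'a set" and G :: "('a \<Rightarrow> 'a) set"
  assumes "domain S"
    and "subring R S"
    and "subgroup G (RingAutoGroup S)"
    and "finite G"
    and "\<forall>\<sigma>\<in>G. \<sigma> ` R \<subseteq> R"
    and "PVD_pair R S"
  shows "PVD_pair (fixed_set G R) (S \<lparr>carrier := fixed_set G (carrier S)\<rparr>)"
proof -
  interpret S: domain S by (rule assms(1))
  have RS: "R \<subseteq> carrier S" using subringE(1)[OF assms(2)] .
  have inv: "subring (fixed_set G R) S" "subring (fixed_set G (carrier S)) S"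
    using S.fixed_set_subring[OF assms(3)] assms(2) S.carrier_is_subring by auto
  note sub = S.subring_subring_iff[OF inv(2)]
  have pv: "pseudo_valuative (S\<lparr>carrier := T\<rparr>)" if "subring T S" "R \<subseteq> T" for T
    using domain.PVD_iff_pseudo_valuative[OF S.subring_is_domain[OF that(1)]] assms(6) that
    by (auto simp: PVD_pair_def)
  have "fixed_set G R \<subseteq> fixed_set G (carrier S)" using RS by (auto simp: fixed_set_def)
  moreover have "PVD (S\<lparr>carrier := T\<rparr>)"
    if T: "subring T S" "T \<subseteq> fixed_set G (carrier S)" "fixed_set G R \<subseteq> T" for T
    using S.pseudo_valuative_between_invariants[OF assms(2) pv assms(3,4,5) T(1,3,2)]
      domain.PVD_iff_pseudo_valuative[OF S.subring_is_domain[OF T(1)]] by blast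
  ultimately show ?thesis
    unfolding PVD_pair_def using inv(1) by (simp add: sub)
qed

end
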